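(* Let $\mathcal{M}$ be a commutative $W^*$-algebra with unit $\mathbf{1}$, let $\mathcal{N}=\mathcal{M}\otimes M_2$, let $H$ be a complex Hilbert space, and let $F:\mathcal{N}\to H$ be an orthogonal vector field. For $i,j\in\{1,2\}$ define $F_{ij}:\mathcal{M}\to H$ by $F_{ij}(a)=F(a\varepsilon_{ij})$, $a\in\mathcal{M}$. Then: (i) $\langle F_{11}(a),F_{22}(b)\rangle=\langle F_{12}(a),F_{21}(b)\rangle=0$ for all $a,b\in\mathcal{M}$; (ii) $\|F_{12}(a)\|^2+\|F_{21}(a)\|^2=\|F_{11}(a)\|^2+\|F_{22}(a)\|^2$ for all $a\in\mathcal{M}$; (iii) $\langle F_{ij}(a),F_{kl}(b)\rangle=\langle F_{ij}(b^*a),F_{kl}(\mathbf{1})\rangle$ for all $a,b\in\mathcal{M}$ and all $i,j,k,l\in\{1,2\}$; (iv) $\langle F_{12}(\pi),F_{11}(\mathbf{1})\rangle=\langle F_{22}(\mathbf{1}),F_{21}(\pi)\rangle$ and $\langle F_{21}(\pi),F_{11}(\mathbf{1})\rangle=\langle F_{22}(\mathbf{1}),F_{12}(\pi)\rangle$ for all $\pi\in\mathcal{M}^{\mathrm{pr}}$.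
   Context: For a $W^*$-algebra $\mathcal{A}$, $\mathcal{A}^{\mathrm{pr}}$ denotes the set of orthogonal projections in $\mathcal{A}$. Inner products are linear in the first argument. A bounded linear map $F:\mathcal{A}\to H$ into a complex Hilbert space $H$ is an orthogonal vector field (OVF) if for all $p,q\in\mathcal{A}^{\mathrm{pr}}$, $pq=0$ implies $\langle F(p),F(q)\rangle=0$. Every $W^*$-algebra of type $I_2$ has the form $\mathcal{N}=\mathcal{M}\otimes M_2$ with $\mathcal{M}$ a commutative $W^*$-algebra and $M_2$ the algebra of $2\times 2$ complex matrices; its elements are the $2\times2$ matrices $(x_{ij})$ with entries $x_{ij}\in\mathcal{M}$. For $a\in\mathcal{M}$, $a\varepsilon_{ij}\in\mathcal{N}$ denotes the matrix whose $(i,j)$ entry is $a$ and whose other entries are $0$. *)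

theory Defs
  imports "HOL-Analysis.Analysis"
begin

section \<open>Complex Banach spaces, Hilbert spaces and C*-algebras\<close>

text \<open>
  The distribution only has real vector space classes.  The classes below add a complex scalar
  multiplication that extends the real one.
\<close>

class complex_normed_vector = real_normed_vector +
  fixes scaleC :: "complex \<Rightarrow> 'a \<Rightarrow> 'a"  (infixr "*\<^sub>C" 75)
  assumes scaleC_add_right: "c *\<^sub>C (x + y) = c *\<^sub>C x + c *\<^sub>C y"
    and scaleC_add_left: "(c + d) *\<^sub>C x = c *\<^sub>C x + d *\<^sub>C x"
    and scaleC_scaleC: "c *\<^sub>C d *\<^sub>C x = (c * d) *\<^sub>C x"
    and scaleC_of_real: "complex_of_real r *\<^sub>C x = r *\<^sub>R x"
    and norm_scaleC: "norm (c *\<^sub>C x) = cmod c * norm x"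

class complex_banach = complex_normed_vector + banach

text \<open>The inner product is linear in the \<^emph>\<open>first\<close> argument.\<close>

class complex_hilbert = complex_banach +
  fixes cinner :: "'a \<Rightarrow> 'a \<Rightarrow> complex"
  assumes cinner_add_left: "cinner (x + y) z = cinner x z + cinner y z"
    and cinner_scaleC_left: "cinner (c *\<^sub>C x) y = c * cinner x y"
    and cinner_commute: "cinner x y = cnj (cinner y x)"
    and cinner_self: "cinner x x = complex_of_real ((norm x)\<^sup>2)"

text \<open>Unital C*-algebras; the unit is required to be nonzero.\<close>

class cstar_algebra = complex_banach + real_normed_algebra_1 +
  fixes star :: "'a \<Rightarrow> 'a"
  assumes scaleC_mult_left: "(c *\<^sub>C a) * b = c *\<^sub>C (a * b)"
    and scaleC_mult_right: "a * (c *\<^sub>C b) = c *\<^sub>C (a * b)"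
    and star_star: "star (star a) = a"
    and star_add: "star (a + b) = star a + star b"
    and star_scaleC: "star (c *\<^sub>C a) = cnj c *\<^sub>C star a"
    and star_mult: "star (a * b) = star b * star a"
    and cstar_identity: "norm (star a * a) = (norm a)\<^sup>2"

class comm_cstar_algebra = cstar_algebra + comm_ring_1

instantiation complex :: comm_cstar_algebra
begin
definition scaleC_complex :: "complex \<Rightarrow> complex \<Rightarrow> complex" where "scaleC_complex = (*)"
definition star_complex :: "complex \<Rightarrow> complex" where "star_complex = cnj"
instance
  by standard
    (auto simp: scaleC_complex_def star_complex_def algebra_simps norm_mult scaleR_conv_of_real
      power2_eq_square)
end

definition bounded_clinear :: "('a::complex_normed_vector \<Rightarrow> 'b::complex_normed_vector) \<Rightarrow> bool"
  where "bounded_clinear f \<longleftrightarrow> bounded_linear f \<and> (\<forall>c x. f (c *\<^sub>C x) = c *\<^sub>C f x)"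

definition is_projection :: "'a::cstar_algebra \<Rightarrow> bool"
  where "is_projection p \<longleftrightarrow> star p = p \<and> p * p = p"

text \<open>
  A W*-algebra is a C*-algebra that is isometrically isomorphic, as a Banach space, to the dual of
  some Banach space.  As HOL has no quantification over types, the isomorphism
  \<open>D\<close> of \<open>'a\<close> onto the dual of the predual \<open>'e\<close> is made explicit.
\<close>

definition wstar_predual :: "('a::cstar_algebra \<Rightarrow> 'e::complex_banach \<Rightarrow> complex) \<Rightarrow> bool"
  where "wstar_predual D \<longleftrightarrow>
    (\<forall>a b x. D (a + b) x = D a x + D b x) \<and>
    (\<forall>c a x. D (c *\<^sub>C a) x = c * D a x) \<and>
    range D = {f. bounded_clinear f} \<and>
    (\<forall>a. onorm (D a) = norm a)"

definition orthogonal_vector_field :: "('a::cstar_algebra \<Rightarrow> 'h::complex_hilbert) \<Rightarrow> bool"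
  where "orthogonal_vector_field F \<longleftrightarrow> bounded_clinear F \<and>
    (\<forall>p q. is_projection p \<longrightarrow> is_projection q \<longrightarrow> p * q = 0 \<longrightarrow> cinner (F p) (F q) = 0)"


section \<open>An inequality in commutative C*-algebras\<close>

lemma scaleC_zero_right [simp]: "c *\<^sub>C (0::'a::complex_normed_vector) = 0"
  using scaleC_add_right[of c 0 "0::'a"] by simp

lemma scaleC_minus_right: "c *\<^sub>C (- (x::'a::complex_normed_vector)) = - (c *\<^sub>C x)"
  by (metis add_eq_0_iff scaleC_add_right scaleC_zero_right add.right_inverse)

lemma scaleC_one [simp]: "1 *\<^sub>C (x::'a::complex_normed_vector) = x"
  using scaleC_of_real[of 1 x] by simp

lemma star_scaleR: "star (r *\<^sub>R (a::'a::cstar_algebra)) = r *\<^sub>R star a"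
  using star_scaleC[of "complex_of_real r" a] by (simp add: scaleC_of_real)

lemma star_zero [simp]: "star (0::'a::cstar_algebra) = 0"
  using star_add[of 0 "0::'a"] by simp

lemma star_minus: "star (- (a::'a::cstar_algebra)) = - star a"
  using star_scaleR[of "-1" a] by simp

lemma star_diff: "star (a - b) = star a - star (b::'a::cstar_algebra)"
  using star_add[of a "- b"] by (simp add: star_minus)

lemma star_one [simp]: "star (1::'a::cstar_algebra) = 1"
  by (metis mult.right_neutral mult.left_neutral star_mult star_star)

lemma norm_star: "norm (star (a::'a::cstar_algebra)) = norm a"
proof -
  have le: "norm b \<le> norm (star b)" for b :: 'a
  proof (cases "b = 0")
    case False
    have "(norm b)\<^sup>2 \<le> norm (star b) * norm b"
      using cstar_identity[of b] norm_mult_ineq[of "star b" b] by simp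
    then show ?thesis using False by (simp add: power2_eq_square)
  qed simp
  show ?thesis using le[of a] le[of "star a"] by (simp add: star_star)
qed

lemma sqrt_exists:
  fixes x :: "'a::comm_cstar_algebra"
  assumes sa: "star x = x" and x: "norm x < 1"
  shows "\<exists>y. star y = y \<and> y * y = 1 - x"
proof -
  define r where "r = norm x"
  have r: "0 \<le> r" "r < 1" using x by (auto simp: r_def)
  define f where "f z = (1/2) *\<^sub>R (x + z * z)" for z
  have "\<exists>!z\<in>cball 0 r. f z = z"
  proof (rule Banach_fix[where c = r])
    show "complete (cball (0::'a) r)" by (simp add: complete_eq_closed)
    show "cball (0::'a) r \<noteq> {}" using r by simp
    show "f ` cball 0 r \<subseteq> cball 0 r"
    proof clarsimp
      fix z :: 'a assume z: "norm z \<le> r"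
      have "norm (z * z) \<le> norm z * norm z" by (rule norm_mult_ineq)
      also have "\<dots> \<le> r * 1" using z r by (intro mult_mono) auto
      finally have "norm (x + z * z) \<le> 2 * r"
        using norm_triangle_ineq[of x "z * z"] by (simp add: r_def)
      then show "norm (f z) \<le> r" by (simp add: f_def)
    qed
    fix z w :: 'a assume "z \<in> cball 0 r" "w \<in> cball 0 r"
    then have zw: "norm z \<le> r" "norm w \<le> r" by auto
    have "(x + z * z) - (x + w * w) = (z + w) * (z - w)" by (simp add: algebra_simps)
    then have "f z - f w = (1/2) *\<^sub>R ((z + w) * (z - w))"
      unfolding f_def by (metis scaleR_diff_right)
    then have "dist (f z) (f w) = norm ((z + w) * (z - w)) / 2" by (simp add: dist_norm)
    also have "\<dots> \<le> norm (z + w) * norm (z - w) / 2" by (simp add: norm_mult_ineq)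
    also have "\<dots> \<le> (2 * r) * norm (z - w) / 2"
      using norm_triangle_ineq[of z w] zw by (intro divide_right_mono mult_right_mono) auto
    finally show "dist (f z) (f w) \<le> r * dist z w" by (simp add: dist_norm)
  qed (use r in auto)
  then obtain z where z: "z \<in> cball 0 r" "f z = z"
    and u: "\<And>w. w \<in> cball 0 r \<Longrightarrow> f w = w \<Longrightarrow> w = z" by blast
  have "f (star z) = star (f z)" by (simp add: f_def star_scaleR star_add star_mult sa)
  then have sz: "star z = z" using z by (intro u) (auto simp: norm_star)
  have "x + z * z = 2 *\<^sub>R f z" by (simp add: f_def)
  then have "x + z * z = z + z" using z(2) by (simp add: scaleR_2)
  then have "(1 - z) * (1 - z) = 1 - x" by (simp add: algebra_simps)
  moreover have "star (1 - z) = 1 - z" by (simp add: star_diff sz)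
  ultimately show ?thesis by blast
qed

lemma norm_square_le:
  fixes y z :: "'a::comm_cstar_algebra"
  assumes sa: "star y = y" "star z = z"
  shows "norm (y * y) \<le> norm (y * y + z * z)"
proof -
  let ?N = "norm (y * y + z * z)"
  have *: "norm (y + c *\<^sub>C z) = sqrt ?N" if "cnj c = - c" "c * c = -1" for c
  proof -
    have "star (y + c *\<^sub>C z) * (y + c *\<^sub>C z) = y * y + c *\<^sub>C (y * z) + (- c) *\<^sub>C (y * z) + (- c * c) *\<^sub>C (z * z)"
      using that by (simp add: star_add star_scaleC sa distrib_left distrib_right scaleC_mult_left
          scaleC_mult_right scaleC_scaleC mult.commute)
    also have "\<dots> = y * y + (c + - c) *\<^sub>C (y * z) + z * z"
      using that by (simp only: scaleC_add_left) (simp add: add.assoc)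
    also have "\<dots> = y * y + z * z" using scaleC_of_real[of 0 "y * z"] by simp
    finally show ?thesis using cstar_identity[of "y + c *\<^sub>C z"] by (simp add: real_sqrt_unique)
  qed
  have a: "2 *\<^sub>R y = (y + \<i> *\<^sub>C z) + (y + (- \<i>) *\<^sub>C z)"
    using scaleC_add_left[of \<i> "- \<i>" z] scaleC_of_real[of 0 z] by (simp add: scaleR_2 algebra_simps)
  have "2 * norm y \<le> sqrt ?N + sqrt ?N"
    using norm_triangle_ineq[of "y + \<i> *\<^sub>C z" "y + (- \<i>) *\<^sub>C z"] a[symmetric] *[of \<i>] *[of "- \<i>"]
    by simp
  then have "(norm y)\<^sup>2 \<le> (sqrt ?N)\<^sup>2" by (intro power_mono) auto
  then show ?thesis using cstar_identity[of y] sa by simp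
qed

lemma star_mult_self_decomp:
  fixes a :: "'a::comm_cstar_algebra"
  obtains x y where "star x = x" "star y = y" "star a * a = x * x + y * y"
proof
  let ?x = "(1/2) *\<^sub>R (a + star a)" and ?y = "(1/2) *\<^sub>R (\<i> *\<^sub>C (star a - a))"
  show "star ?x = ?x" by (simp add: star_scaleR star_add star_star add.commute)
  have "(- \<i>) *\<^sub>C (a - star a) = \<i> *\<^sub>C (star a - a)"
    using scaleC_scaleC[of \<i> "-1" "a - star a"] scaleC_of_real[of "-1" "a - star a"] by simp
  then show "star ?y = ?y" by (simp add: star_scaleR star_scaleC star_diff star_star)
  have "(\<i> *\<^sub>C (star a - a)) * (\<i> *\<^sub>C (star a - a)) = - ((star a - a) * (star a - a))"
    using scaleC_of_real[of "-1" "(star a - a) * (star a - a)"]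
    by (simp add: scaleC_mult_left scaleC_mult_right scaleC_scaleC)
  then have "?x * ?x + ?y * ?y = (1/4) *\<^sub>R ((a + star a) * (a + star a) - (star a - a) * (star a - a))"
    by (simp add: scaleR_diff_right)
  also have "(a + star a) * (a + star a) - (star a - a) * (star a - a) = 4 *\<^sub>R (star a * a)"
  proof -
    have "4 *\<^sub>R (star a * a) = 2 *\<^sub>R (2 *\<^sub>R (star a * a))" by simp
    then show ?thesis by (simp only: scaleR_2) (simp add: algebra_simps)
  qed
  finally show "star a * a = ?x * ?x + ?y * ?y" by simp
qed

lemma star_mult_self_sqrt:
  fixes a :: "'a::comm_cstar_algebra"
  assumes e: "0 < e"
  shows "\<exists>c. star c = c \<and> c * c = star a * a + e *\<^sub>R 1"
proof -
  obtain x y where xy: "star x = x" "star y = y" "star a * a = x * x + y * y"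
    by (rule star_mult_self_decomp)
  define t where "t = (norm x + norm y + 1)\<^sup>2"
  have p: "0 < norm x + norm y + 1" by (simp add: add_nonneg_pos)
  then have t: "0 < t" by (simp add: t_def)
  have le: "norm (t *\<^sub>R 1 - w * w) \<le> t" if w: "star w = w" "norm w < norm x + norm y + 1" for w :: 'a
  proof -
    have "norm (w * w) \<le> norm w * norm w" by (rule norm_mult_ineq)
    also have "\<dots> < t" unfolding t_def power2_eq_square using w(2) p by (intro mult_strict_mono) auto
    finally have "norm ((1/t) *\<^sub>R (w * w)) < 1" using t by (simp add: field_simps)
    moreover have "star ((1/t) *\<^sub>R (w * w)) = (1/t) *\<^sub>R (w * w)" by (simp add: star_scaleR star_mult w)
    ultimately obtain z where z: "star z = z" "z * z = 1 - (1/t) *\<^sub>R (w * w)"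
      using sqrt_exists by blast
    let ?z = "sqrt t *\<^sub>R z"
    have zz: "?z * ?z = t *\<^sub>R 1 - w * w" using t z by (simp add: scaleR_diff_right)
    have "norm (?z * ?z) \<le> norm (?z * ?z + w * w)"
      by (rule norm_square_le) (auto simp: star_scaleR z w)
    also have "?z * ?z + w * w = t *\<^sub>R 1" unfolding zz by simp
    finally show ?thesis unfolding zz using t by simp
  qed
  define T where "T = 2 * t + e"
  have T: "0 < T" using t e by (simp add: T_def)
  define w where "w = (1/T) *\<^sub>R ((t *\<^sub>R 1 - x * x) + (t *\<^sub>R 1 - y * y))"
  have "norm ((t *\<^sub>R 1 - x * x) + (t *\<^sub>R 1 - y * y)) \<le> t + t"
    by (intro norm_triangle_mono le) (auto simp: xy add.commute add_nonneg_pos intro: add_strict_increasing)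
  moreover have "norm w = norm ((t *\<^sub>R 1 - x * x) + (t *\<^sub>R 1 - y * y)) / T"
    unfolding w_def using T by simp
  ultimately have "norm w < 1" using T e by (simp add: T_def)
  moreover have "star (t *\<^sub>R 1 - u * u) = t *\<^sub>R 1 - u * u" if "star u = u" for u :: 'a
    using that by (simp add: star_diff star_scaleR star_mult)
  then have "star w = w" by (simp only: w_def star_scaleR star_add xy)
  ultimately obtain z where z: "star z = z" "z * z = 1 - w" using sqrt_exists by blast
  have "(sqrt T *\<^sub>R z) * (sqrt T *\<^sub>R z) = T *\<^sub>R (1 - w)" using T z by simp
  also have "\<dots> = T *\<^sub>R 1 - ((t *\<^sub>R 1 - x * x) + (t *\<^sub>R 1 - y * y))"
    using T by (simp add: w_def scaleR_diff_right)
  also have "\<dots> = star a * a + e *\<^sub>R 1" using scaleR_add_left[of t t "1::'a"]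
    by (simp add: T_def xy(3) scaleR_add_left)
  finally show ?thesis using z by (intro exI[of _ "sqrt T *\<^sub>R z"]) (simp add: star_scaleR)
qed

lemma norm_star_mult_self_le:
  fixes a b :: "'a::comm_cstar_algebra"
  shows "norm (star a * a) \<le> norm (star a * a + star b * b)"
proof (rule field_le_epsilon)
  fix e :: real assume "0 < e"
  define d where "d = e / 3"
  have d: "0 < d" using \<open>0 < e\<close> by (simp add: d_def)
  obtain u where u: "star u = u" "u * u = star a * a + d *\<^sub>R 1" using star_mult_self_sqrt[OF d] by blast
  obtain v where v: "star v = v" "v * v = star b * b + d *\<^sub>R 1" using star_mult_self_sqrt[OF d] by blast
  have "norm (star a * a) \<le> norm (u * u) + norm (d *\<^sub>R (1::'a))"
    using norm_triangle_ineq4[of "u * u" "d *\<^sub>R 1"] by (simp add: u)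
  also have "norm (u * u) \<le> norm (u * u + v * v)" using u v by (intro norm_square_le)
  also have "u * u + v * v = (star a * a + star b * b) + (2 * d) *\<^sub>R 1"
    using scaleR_add_left[of d d "1::'a"] by (simp add: u v)
  also have "norm \<dots> \<le> norm (star a * a + star b * b) + norm ((2 * d) *\<^sub>R (1::'a))"
    by (rule norm_triangle_ineq)
  finally show "norm (star a * a) \<le> norm (star a * a + star b * b) + e" using d by (simp add: d_def)
qed

section \<open>Two by two matrices over a commutative C*-algebra\<close>

typedef 'a mat2 = "UNIV :: ('a^2^2) set"
  morphisms to_matrix of_matrix by simp

lemma to_matrix_of_matrix [simp]: "to_matrix (of_matrix A) = A"
  by (simp add: of_matrix_inverse)

lemma mat2_eqI: "(\<And>i j. to_matrix A $ i $ j = to_matrix B $ i $ j) \<Longrightarrow> A = B"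
  by (simp add: vec_eq_iff flip: to_matrix_inject)

text \<open>
  Columns \<open>'a^2\<close> form a Hilbert \<open>'a\<close>-module, and the C*-norm of a matrix is
  its operator norm on this module.
\<close>

definition module_inner :: "'a::cstar_algebra^2 \<Rightarrow> 'a^2 \<Rightarrow> 'a"
  where "module_inner u v = (\<Sum>i\<in>UNIV. star (u $ i) * (v $ i))"

definition module_norm :: "'a::cstar_algebra^2 \<Rightarrow> real"
  where "module_norm v = sqrt (norm (module_inner v v))"

definition matrix_norm :: "'a::cstar_algebra^2^2 \<Rightarrow> real"
  where "matrix_norm A = (SUP v\<in>{v. module_norm v \<le> 1}. module_norm (A *v v))"

lemma module_inner_eq: "module_inner u v = star (u $ 1) * (v $ 1) + star (u $ 2) * (v $ 2)"
  by (simp add: module_inner_def sum_2)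

lemma module_norm_nonneg [simp]: "0 \<le> module_norm v"
  by (simp add: module_norm_def)

lemma module_norm_power2: "(module_norm v)\<^sup>2 = norm (module_inner v v)"
  by (simp add: module_norm_def)

lemma module_norm_axis [simp]: "module_norm (axis j a) = norm (a::'a::cstar_algebra)"
  using exhaust_2[of j] by (auto simp: module_norm_def module_inner_eq axis_def cstar_identity)

lemma module_norm_scaleR: "module_norm (r *\<^sub>R v) = \<bar>r\<bar> * module_norm (v::'a::cstar_algebra^2)"
proof -
  have "module_inner (r *\<^sub>R v) (r *\<^sub>R v) = (r * r) *\<^sub>R module_inner v v"
    by (simp add: module_inner_eq star_scaleR scaleR_add_right)
  then show ?thesis by (simp add: module_norm_def real_sqrt_mult abs_mult)
qed

lemma norm_nth_le_module_norm: "norm (v $ i) \<le> module_norm (v::'a::comm_cstar_algebra^2)"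
proof -
  have "(norm (v $ i))\<^sup>2 \<le> (module_norm v)\<^sup>2"
    using norm_star_mult_self_le[of "v $ 1" "v $ 2"] norm_star_mult_self_le[of "v $ 2" "v $ 1"]
      exhaust_2[of i]
    by (auto simp: module_norm_power2 module_inner_eq cstar_identity add.commute)
  then show ?thesis by (rule power2_le_imp_le) simp
qed

lemma module_Cauchy_Schwarz:
  fixes u v :: "'a::comm_cstar_algebra^2"
  shows "norm (module_inner u v) \<le> module_norm u * module_norm v"
proof -
  let ?d = "u $ 1 * v $ 2 - u $ 2 * v $ 1"
  let ?w = "module_inner u v"
  let ?e = "star (u $ 1) * star (v $ 2) - star (u $ 2) * star (v $ 1)"
  have w: "star ?w = star (v $ 1) * u $ 1 + star (v $ 2) * u $ 2"
    by (simp add: module_inner_eq star_add star_mult star_star)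
  have d: "star ?d = ?e"
    by (simp add: star_diff star_mult mult.commute)
  have "star ?w * ?w + star ?d * ?d = module_inner u u * module_inner v v"
    unfolding w d by (simp add: module_inner_eq algebra_simps)
  then have "norm (star ?w * ?w) \<le> norm (module_inner u u * module_inner v v)"
    by (metis norm_star_mult_self_le)
  also have "\<dots> \<le> norm (module_inner u u) * norm (module_inner v v)" by (rule norm_mult_ineq)
  finally have "(norm ?w)\<^sup>2 \<le> (module_norm u * module_norm v)\<^sup>2"
    by (simp add: cstar_identity power_mult_distrib module_norm_power2)
  then show ?thesis by (rule power2_le_imp_le) simp
qed

lemma module_norm_triangle:
  fixes u v :: "'a::comm_cstar_algebra^2"
  shows "module_norm (u + v) \<le> module_norm u + module_norm v"
proof -
  have "module_inner (u + v) (u + v)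
      = (module_inner u u + module_inner u v) + (module_inner v u + module_inner v v)"
    by (simp add: module_inner_eq star_add algebra_simps)
  then have "norm (module_inner (u + v) (u + v))
      \<le> (norm (module_inner u u) + norm (module_inner u v)) + (norm (module_inner v u) + norm (module_inner v v))"
    by (metis norm_triangle_mono norm_triangle_ineq)
  also have "\<dots> \<le> (module_norm u + module_norm v)\<^sup>2"
    using module_Cauchy_Schwarz[of u v] module_Cauchy_Schwarz[of v u]
    by (simp add: power2_eq_square algebra_simps flip: module_norm_power2)
  finally have "(module_norm (u + v))\<^sup>2 \<le> (module_norm u + module_norm v)\<^sup>2"
    by (simp add: module_norm_power2)
  then show ?thesis by (rule power2_le_imp_le) simp
qed

lemma module_norm_le: "module_norm (v::'a::comm_cstar_algebra^2) \<le> norm (v $ 1) + norm (v $ 2)"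
proof -
  have "v = axis 1 (v $ 1) + axis 2 (v $ 2)" by (simp add: vec_eq_iff forall_2 axis_def)
  then show ?thesis by (metis module_norm_triangle module_norm_axis)
qed

lemma module_norm_matrix_bound:
  fixes A :: "'a::comm_cstar_algebra^2^2"
  shows "module_norm (A *v v) \<le> (\<Sum>i\<in>UNIV. \<Sum>j\<in>UNIV. norm (A $ i $ j)) * module_norm v"
proof -
  have "norm ((A *v v) $ i) \<le> (\<Sum>j\<in>UNIV. norm (A $ i $ j)) * module_norm v" for i
    unfolding matrix_vector_mult_def vec_lambda_beta sum_distrib_right
    by (intro sum_norm_le order_trans[OF norm_mult_ineq] mult_left_mono norm_nth_le_module_norm) simp
  from add_mono[OF this[of 1] this[of 2]] show ?thesis
    using module_norm_le[of "A *v v"] by (simp add: sum_2 distrib_right)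
qed

lemma matrix_norm_upper:
  fixes A :: "'a::comm_cstar_algebra^2^2"
  assumes "module_norm v \<le> 1"
  shows "module_norm (A *v v) \<le> matrix_norm A"
  unfolding matrix_norm_def
proof (rule cSUP_upper)
  let ?K = "\<Sum>i\<in>UNIV. \<Sum>j\<in>UNIV. norm (A $ i $ j)"
  have "?K * module_norm v \<le> ?K * 1" if "module_norm v \<le> 1" for v :: "'a^2"
    using that by (intro mult_left_mono sum_nonneg) auto
  then show "bdd_above ((\<lambda>v. module_norm (A *v v)) ` {v. module_norm v \<le> 1})"
    using module_norm_matrix_bound[of A] by (intro bdd_aboveI2[of _ _ ?K]) (fastforce intro: order_trans)
qed (use assms in auto)

lemma matrix_norm_nonneg: "0 \<le> matrix_norm (A::'a::comm_cstar_algebra^2^2)"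
  using matrix_norm_upper[of "axis 1 0" A] by (rule order_trans[rotated]) auto

lemma matrix_norm_bound:
  fixes A :: "'a::comm_cstar_algebra^2^2"
  shows "module_norm (A *v v) \<le> matrix_norm A * module_norm v"
proof (cases "module_norm v = 0")
  case True
  then show ?thesis using module_norm_matrix_bound[of A v] by simp
next
  case False
  then have pos: "0 < module_norm v" by (simp add: less_le)
  have "A *v ((1 / module_norm v) *\<^sub>R v) = (1 / module_norm v) *\<^sub>R (A *v v)"
    by (simp add: matrix_vector_mult_def vec_eq_iff scaleR_sum_right)
  then have "(1 / module_norm v) * module_norm (A *v v) \<le> matrix_norm A"
    using matrix_norm_upper[of "(1 / module_norm v) *\<^sub>R v" A] pos by (simp add: module_norm_scaleR)
  then show ?thesis using pos by (simp add: field_simps)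
qed

lemma matrix_norm_least:
  fixes A :: "'a::comm_cstar_algebra^2^2"
  assumes "\<And>v. module_norm (A *v v) \<le> K * module_norm v" and "0 \<le> K"
  shows "matrix_norm A \<le> K"
  unfolding matrix_norm_def
proof (rule cSUP_least)
  have "axis 1 0 \<in> {v::'a^2. module_norm v \<le> 1}" by simp
  then show "{v::'a^2. module_norm v \<le> 1} \<noteq> {}" by blast
  fix v :: "'a^2" assume "v \<in> {v. module_norm v \<le> 1}"
  then have "K * module_norm v \<le> K * 1" using assms(2) by (intro mult_left_mono) auto
  then show "module_norm (A *v v) \<le> K" using assms(1)[of v] by simp
qed

lemma matrix_norm_le_sum:
  fixes A :: "'a::comm_cstar_algebra^2^2"
  shows "matrix_norm A \<le> (\<Sum>i\<in>UNIV. \<Sum>j\<in>UNIV. norm (A $ i $ j))"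
  by (intro matrix_norm_least module_norm_matrix_bound sum_nonneg) auto

lemma norm_entry_le_matrix_norm:
  fixes A :: "'a::comm_cstar_algebra^2^2"
  shows "norm (A $ i $ j) \<le> matrix_norm A"
proof -
  have "(A *v axis j 1) $ i = A $ i $ j"
    using exhaust_2[of j] by (auto simp: matrix_vector_mult_def sum_2 axis_def)
  then have "norm (A $ i $ j) \<le> module_norm (A *v axis j 1)" by (metis norm_nth_le_module_norm)
  also have "\<dots> \<le> matrix_norm A" by (rule matrix_norm_upper) simp
  finally show ?thesis .
qed

lemma matrix_norm_triangle:
  fixes A B :: "'a::comm_cstar_algebra^2^2"
  shows "matrix_norm (A + B) \<le> matrix_norm A + matrix_norm B"
proof (rule matrix_norm_least)
  fix v :: "'a^2"
  show "module_norm ((A + B) *v v) \<le> (matrix_norm A + matrix_norm B) * module_norm v"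
    using module_norm_triangle[of "A *v v" "B *v v"] matrix_norm_bound[of A v] matrix_norm_bound[of B v]
    by (simp add: matrix_vector_mult_add_rdistrib distrib_right)
qed (simp add: matrix_norm_nonneg)

lemma matrix_norm_mult:
  fixes A B :: "'a::comm_cstar_algebra^2^2"
  shows "matrix_norm (A ** B) \<le> matrix_norm A * matrix_norm B"
proof (rule matrix_norm_least)
  fix v :: "'a^2"
  have "module_norm (A *v (B *v v)) \<le> matrix_norm A * module_norm (B *v v)" by (rule matrix_norm_bound)
  also have "\<dots> \<le> matrix_norm A * (matrix_norm B * module_norm v)"
    by (intro mult_left_mono matrix_norm_bound matrix_norm_nonneg)
  finally show "module_norm ((A ** B) *v v) \<le> matrix_norm A * matrix_norm B * module_norm v"
    by (simp add: matrix_vector_mul_assoc mult.assoc)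
qed (simp add: matrix_norm_nonneg)

definition matrix_star :: "'a::cstar_algebra^2^2 \<Rightarrow> 'a^2^2"
  where "matrix_star A = (\<chi> i j. star (A $ j $ i))"

definition matrix_scaleC :: "complex \<Rightarrow> 'a::cstar_algebra^2^2 \<Rightarrow> 'a^2^2"
  where "matrix_scaleC c A = (\<chi> i j. c *\<^sub>C (A $ i $ j))"

lemma matrix_norm_scaleC:
  fixes A :: "'a::comm_cstar_algebra^2^2"
  shows "matrix_norm (matrix_scaleC c A) = cmod c * matrix_norm A"
proof -
  have m: "module_norm (matrix_scaleC c A *v v) = cmod c * module_norm (A *v v)" for c v and A :: "'a^2^2"
  proof -
    let ?w = "A *v v"
    have w: "(matrix_scaleC c A *v v) $ i = c *\<^sub>C (?w $ i)" for i
      by (simp add: matrix_vector_mult_def matrix_scaleC_def sum_2 scaleC_add_right scaleC_mult_left)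
    have "module_inner (matrix_scaleC c A *v v) (matrix_scaleC c A *v v) = (cnj c * c) *\<^sub>C module_inner ?w ?w"
      by (simp add: module_inner_eq w star_scaleC scaleC_mult_left scaleC_mult_right scaleC_scaleC
          scaleC_add_right mult.commute)
    then show ?thesis by (simp add: module_norm_def norm_scaleC norm_mult real_sqrt_mult)
  qed
  have le: "matrix_norm (matrix_scaleC c A) \<le> cmod c * matrix_norm A" for c and A :: "'a^2^2"
    by (rule matrix_norm_least)
      (auto simp: m mult.assoc matrix_norm_nonneg intro!: mult_left_mono matrix_norm_bound)
  show ?thesis
  proof (cases "c = 0")
    case True
    then show ?thesis using le[of c A] matrix_norm_nonneg[of "matrix_scaleC c A"] by simp
  next
    case False
    have "matrix_scaleC (inverse c) (matrix_scaleC c A) = A"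
      using False by (simp add: matrix_scaleC_def vec_eq_iff scaleC_scaleC)
    then have "matrix_norm A \<le> cmod (inverse c) * matrix_norm (matrix_scaleC c A)"
      using le[of "inverse c" "matrix_scaleC c A"] by simp
    then show ?thesis using le[of c A] False by (simp add: norm_inverse norm_divide field_simps)
  qed
qed

lemma matrix_cstar_identity:
  fixes A :: "'a::comm_cstar_algebra^2^2"
  shows "matrix_norm (matrix_star A ** A) = (matrix_norm A)\<^sup>2"
proof -
  have le: "(matrix_norm A)\<^sup>2 \<le> matrix_norm (matrix_star A ** A)" for A :: "'a^2^2"
  proof -
    let ?N = "matrix_norm (matrix_star A ** A)"
    have "matrix_norm A \<le> sqrt ?N"
    proof (rule matrix_norm_least)
      fix v :: "'a^2"
      have "module_inner (A *v v) (A *v v) = module_inner v ((matrix_star A ** A) *v v)"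
        by (simp add: module_inner_eq matrix_vector_mult_def matrix_matrix_mult_def matrix_star_def
            sum_2 star_add star_mult algebra_simps)
      then have "(module_norm (A *v v))\<^sup>2 \<le> module_norm v * module_norm ((matrix_star A ** A) *v v)"
        using module_Cauchy_Schwarz[of v "(matrix_star A ** A) *v v"] by (simp add: module_norm_power2)
      also have "\<dots> \<le> module_norm v * (?N * module_norm v)"
        by (intro mult_left_mono matrix_norm_bound) simp
      also have "\<dots> = (sqrt ?N * module_norm v)\<^sup>2"
        by (simp add: power_mult_distrib matrix_norm_nonneg power2_eq_square[of "module_norm v"])
      finally show "module_norm (A *v v) \<le> sqrt ?N * module_norm v"
        by (rule power2_le_imp_le) (simp add: matrix_norm_nonneg)
    qed (simp add: matrix_norm_nonneg)
    then have "(matrix_norm A)\<^sup>2 \<le> (sqrt ?N)\<^sup>2" by (intro power_mono matrix_norm_nonneg)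
    then show ?thesis by (simp add: matrix_norm_nonneg)
  qed
  have star_le: "matrix_norm A \<le> matrix_norm (matrix_star A)" for A :: "'a^2^2"
  proof (cases "matrix_norm A = 0")
    case False
    have "(matrix_norm A)\<^sup>2 \<le> matrix_norm (matrix_star A) * matrix_norm A"
      using le[of A] matrix_norm_mult[of "matrix_star A" A] by simp
    moreover have "0 < matrix_norm A" using False matrix_norm_nonneg[of A] by simp
    ultimately show ?thesis by (simp add: power2_eq_square)
  qed (simp add: matrix_norm_nonneg)
  have "matrix_star (matrix_star A) = A" by (simp add: matrix_star_def star_star vec_eq_iff)
  then have eq: "matrix_norm (matrix_star A) = matrix_norm A"
    using star_le[of A] star_le[of "matrix_star A"] by simp
  show ?thesis
    using le[of A] matrix_norm_mult[of "matrix_star A" A] by (simp add: eq power2_eq_square)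
qed

instantiation mat2 :: (comm_cstar_algebra) real_normed_algebra_1
begin

definition zero_mat2 :: "'a mat2" where "0 = of_matrix 0"
definition one_mat2 :: "'a mat2" where "1 = of_matrix (mat 1)"
definition plus_mat2 :: "'a mat2 \<Rightarrow> 'a mat2 \<Rightarrow> 'a mat2"
  where "A + B = of_matrix (to_matrix A + to_matrix B)"
definition minus_mat2 :: "'a mat2 \<Rightarrow> 'a mat2 \<Rightarrow> 'a mat2"
  where "A - B = of_matrix (to_matrix A - to_matrix B)"
definition uminus_mat2 :: "'a mat2 \<Rightarrow> 'a mat2" where "- A = of_matrix (- to_matrix A)"
definition times_mat2 :: "'a mat2 \<Rightarrow> 'a mat2 \<Rightarrow> 'a mat2"
  where "A * B = of_matrix (to_matrix A ** to_matrix B)"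
definition scaleR_mat2 :: "real \<Rightarrow> 'a mat2 \<Rightarrow> 'a mat2"
  where "r *\<^sub>R A = of_matrix (r *\<^sub>R to_matrix A)"
definition norm_mat2 :: "'a mat2 \<Rightarrow> real" where "norm A = matrix_norm (to_matrix A)"
definition sgn_mat2_def: "sgn (A :: 'a mat2) = inverse (norm A) *\<^sub>R A"
definition dist_mat2_def: "dist (A :: 'a mat2) B = norm (A - B)"
definition uniformity_mat2 :: "('a mat2 \<times> 'a mat2) filter"
  where "uniformity_mat2 = (INF e\<in>{0 <..}. principal {(A, B). dist A B < e})"
definition open_mat2 :: "'a mat2 set \<Rightarrow> bool"
  where "open_mat2 U \<longleftrightarrow> (\<forall>A\<in>U. eventually (\<lambda>(A', B). A' = A \<longrightarrow> B \<in> U) uniformity)"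

lemmas mat2_defs = zero_mat2_def one_mat2_def plus_mat2_def minus_mat2_def uminus_mat2_def
  times_mat2_def scaleR_mat2_def

instance
proof
  fix A B C :: "'a mat2" and r s :: real
  note ms = matrix_matrix_mult_def mat_def sum_2
  show "A + B + C = A + (B + C)" "A + B = B + A" "0 + A = A" "- A + A = 0" "A - B = A + - B"
    by (simp_all add: mat2_defs algebra_simps to_matrix_inverse)
  show "r *\<^sub>R (A + B) = r *\<^sub>R A + r *\<^sub>R B" "(r + s) *\<^sub>R A = r *\<^sub>R A + s *\<^sub>R A"
    "r *\<^sub>R s *\<^sub>R A = (r * s) *\<^sub>R A" "1 *\<^sub>R A = A"
    by (simp_all add: mat2_defs algebra_simps to_matrix_inverse)
  show "A * B * C = A * (B * C)" "1 * A = A" "A * 1 = A"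
    by (simp_all add: mat2_defs matrix_mul_assoc to_matrix_inverse)
  show "(A + B) * C = A * C + B * C" "A * (B + C) = A * B + A * C"
    "r *\<^sub>R A * B = r *\<^sub>R (A * B)" "A * r *\<^sub>R B = r *\<^sub>R (A * B)"
    by (rule mat2_eqI; simp add: mat2_defs ms distrib_right distrib_left scaleR_add_right)+
  show "(0::'a mat2) \<noteq> 1"
  proof
    assume "(0::'a mat2) = 1"
    then have "to_matrix (0::'a mat2) $ 1 $ 1 = to_matrix (1::'a mat2) $ 1 $ 1" by simp
    then show False by (simp add: mat2_defs mat_def)
  qed
  have "matrix_scaleC (complex_of_real r) (to_matrix A) = r *\<^sub>R to_matrix A"
    by (simp add: matrix_scaleC_def scaleC_of_real vec_eq_iff)
  then show "norm (r *\<^sub>R A) = \<bar>r\<bar> * norm A"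
    using matrix_norm_scaleC[of "complex_of_real r" "to_matrix A"] by (simp add: norm_mat2_def scaleR_mat2_def)
  show "norm (A + B) \<le> norm A + norm B"
    by (simp add: norm_mat2_def plus_mat2_def matrix_norm_triangle)
  show "norm (A * B) \<le> norm A * norm B"
    by (simp add: norm_mat2_def times_mat2_def matrix_norm_mult)
  show "norm A = 0 \<longleftrightarrow> A = 0"
  proof
    assume "norm A = 0"
    then have "to_matrix A $ i $ j = 0" for i j
      using norm_entry_le_matrix_norm[of "to_matrix A" i j] by (simp add: norm_mat2_def)
    then show "A = 0" by (intro mat2_eqI) (simp add: zero_mat2_def)
  next
    assume "A = 0"
    then show "norm A = 0"
      using matrix_norm_le_sum[of "to_matrix A"] matrix_norm_nonneg[of "to_matrix A"]
      by (simp add: norm_mat2_def zero_mat2_def)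
  qed
  have "matrix_norm (mat 1 :: 'a^2^2) \<le> 1" by (rule matrix_norm_least) auto
  then show "norm (1::'a mat2) = 1"
    using norm_entry_le_matrix_norm[of "mat 1 :: 'a^2^2" 1 1]
    by (simp add: norm_mat2_def one_mat2_def mat_def)
  show "sgn A = inverse (norm A) *\<^sub>R A" by (rule sgn_mat2_def)
  show "dist A B = norm (A - B)" by (rule dist_mat2_def)
  show "uniformity = (INF e\<in>{0 <..}. principal {(A::'a mat2, B). dist A B < e})"
    by (rule uniformity_mat2_def)
  show "open U \<longleftrightarrow> (\<forall>A\<in>U. eventually (\<lambda>(A', B). A' = A \<longrightarrow> B \<in> U) uniformity)" for U :: "'a mat2 set"
    by (rule open_mat2_def)
qed

end

instance mat2 :: (comm_cstar_algebra) banach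
proof
  fix X :: "nat \<Rightarrow> 'a mat2"
  assume X: "Cauchy X"
  have "Cauchy (\<lambda>n. to_matrix (X n) $ i $ j)" for i j
  proof (rule CauchyI)
    fix e :: real assume "0 < e"
    then obtain M where M: "\<And>m n. m \<ge> M \<Longrightarrow> n \<ge> M \<Longrightarrow> norm (X m - X n) < e"
      using CauchyD[OF X] by blast
    have "norm (to_matrix (X m) $ i $ j - to_matrix (X n) $ i $ j) \<le> norm (X m - X n)" for m n
      using norm_entry_le_matrix_norm[of "to_matrix (X m - X n)" i j]
      by (simp add: norm_mat2_def minus_mat2_def)
    then show "\<exists>M. \<forall>m\<ge>M. \<forall>n\<ge>M. norm (to_matrix (X m) $ i $ j - to_matrix (X n) $ i $ j) < e"
      using M by (meson order_le_less_trans)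
  qed
  then have "\<exists>l. (\<lambda>n. to_matrix (X n) $ i $ j) \<longlonglongrightarrow> l" for i j
    by (simp add: Cauchy_convergent_iff convergent_def)
  then obtain l where l: "\<And>i j. (\<lambda>n. to_matrix (X n) $ i $ j) \<longlonglongrightarrow> l i j" by metis
  define L where "L = of_matrix (\<chi> i j. l i j)"
  let ?d = "\<lambda>n. \<Sum>i\<in>UNIV. \<Sum>j\<in>UNIV. norm (to_matrix (X n) $ i $ j - l i j)"
  have "?d \<longlonglongrightarrow> 0"
    by (intro tendsto_null_sum tendsto_norm_zero LIM_zero l)
  have le: "norm (X n - L) \<le> ?d n" for n
    using matrix_norm_le_sum[of "to_matrix (X n - L)"] by (simp add: norm_mat2_def minus_mat2_def L_def)
  have "(\<lambda>n. X n - L) \<longlonglongrightarrow> 0"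
    by (rule Lim_null_comparison[OF always_eventually \<open>?d \<longlonglongrightarrow> 0\<close>]) (intro allI le)
  then have "X \<longlonglongrightarrow> L" by (rule LIM_zero_cancel)
  then show "convergent X" by (rule convergentI)
qed

instantiation mat2 :: (comm_cstar_algebra) cstar_algebra
begin

definition scaleC_mat2 :: "complex \<Rightarrow> 'a mat2 \<Rightarrow> 'a mat2"
  where "c *\<^sub>C A = of_matrix (matrix_scaleC c (to_matrix A))"
definition star_mat2 :: "'a mat2 \<Rightarrow> 'a mat2"
  where "star A = of_matrix (matrix_star (to_matrix A))"

instance
proof
  fix A B :: "'a mat2" and r :: real and c d :: complex
  note ms = mat2_defs scaleC_mat2_def star_mat2_def matrix_matrix_mult_def matrix_scaleC_def
    matrix_star_def sum_2
  show "c *\<^sub>C (A + B) = c *\<^sub>C A + c *\<^sub>C B" "(c + d) *\<^sub>C A = c *\<^sub>C A + d *\<^sub>C A"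
    "c *\<^sub>C d *\<^sub>C A = (c * d) *\<^sub>C A" "complex_of_real r *\<^sub>C A = r *\<^sub>R A"
    by (rule mat2_eqI; simp add: ms scaleC_add_right scaleC_add_left scaleC_scaleC scaleC_of_real)+
  show "(c *\<^sub>C A) * B = c *\<^sub>C (A * B)" "A * (c *\<^sub>C B) = c *\<^sub>C (A * B)"
    by (rule mat2_eqI; simp add: ms scaleC_add_right scaleC_mult_left scaleC_mult_right)+
  show "star (star A) = A" "star (A + B) = star A + star B" "star (c *\<^sub>C A) = cnj c *\<^sub>C star A"
    "star (A * B) = star B * star A"
    by (rule mat2_eqI; simp add: ms star_star star_add star_scaleC star_mult)+
  show "norm (c *\<^sub>C A) = cmod c * norm A"
    by (simp add: norm_mat2_def scaleC_mat2_def matrix_norm_scaleC)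
  show "norm (star A * A) = (norm A)\<^sup>2"
    by (simp add: norm_mat2_def times_mat2_def star_mat2_def matrix_cstar_identity)
qed

end

text \<open>\<open>mat_unit i j a\<close> is the matrix \<open>a\<epsilon>\<^sub>i\<^sub>j\<close>.\<close>

definition mat_unit :: "2 \<Rightarrow> 2 \<Rightarrow> 'a::zero \<Rightarrow> 'a mat2"
  where "mat_unit i j a = of_matrix (\<chi> k l. if k = i \<and> l = j then a else 0)"

end

theory Submission
  imports Defs
begin

text \<open>
  On the scalar matrices over a projection \<open>p\<close>, apply orthogonality to the complementary
  projections with rows \<open>(t, u), (cnj u, 1 - t)\<close> and \<open>(1 - t, - u), (- cnj u, t)\<close>, where
  \<open>\<bar>u\<bar>\<^sup>2 = t - t\<^sup>2\<close>; comparing a few values of \<open>t\<close> and \<open>u\<close> gives (i), (ii) and (iv) for \<open>a = b = p\<close>.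
  Matrices supported on disjoint projections of the algebra have orthogonal images, which gives (iii)
  for projections.  Everything extends by linearity and continuity because a bounded linear map
  vanishing on the projections of a commutative W*-algebra is zero.

  The last fact is where the predual enters.  By Banach-Alaoglu, closed balls have the finite
  intersection property, and order intervals of self-adjoint elements are balls.  So if \<open>g, h \<ge> 0\<close> and
  \<open>g h = 0\<close>, then \<open>{x. 0 \<le> x \<le> 1, x g = 0}\<close> has a greatest element, which is a projection \<open>p\<close> with
  \<open>p g = 0\<close> and \<open>(1 - p) h = 0\<close>.  Applied to the positive and negative parts of a self-adjoint \<open>a\<close> with
  \<open>\<parallel>a\<parallel> \<le> 1\<close> it gives a symmetry \<open>s = 2 p - 1\<close> with \<open>a s = \<bar>a\<bar>\<close>, hence \<open>\<parallel>2 a - s\<parallel> \<le> 1\<close>; iterating,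
  \<open>a\<close> is a norm convergent sum of symmetries \<open>s\<^sub>n / 2\<^sup>n\<close>.
\<close>

section \<open>Positive elements of commutative C*-algebras\<close>

lemma bounded_linear_star: "bounded_linear (star :: 'a::cstar_algebra \<Rightarrow> 'a)"
  by (rule bounded_linear_intro[where K = 1]) (auto simp: star_add star_scaleR norm_star)

lemma star_of_real [simp]: "star (of_real r :: 'a::cstar_algebra) = of_real r"
  by (simp add: of_real_def star_scaleR)

text \<open>When \<open>norm x = 1\<close>, the map sending \<open>w\<close> to
  \<open>(1/2) *\<^sub>R (x + w * w)\<close> need not be a contraction of the unit ball, so
  convergence comes from comparison with a monotone bounded scalar sequence. The bound on
  \<open>norm z\<close> is what later makes \<open>1 - z\<close> the nonnegative root.\<close>

lemma sqrt_one_minus: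
  fixes x :: "'a::comm_cstar_algebra"
  assumes sa: "star x = x" and x: "norm x \<le> 1"
  obtains z where "star z = z" "norm z \<le> 1" "(1 - z) * (1 - z) = 1 - x"
proof -
  define z where "z = rec_nat (0::'a) (\<lambda>_ w. (1/2) *\<^sub>R (x + w * w))"
  \<comment> \<open>The scalar iteration for \<open>x = 1\<close> dominates the one for \<open>x\<close>.\<close>
  define r where "r = rec_nat (0::real) (\<lambda>_ w. (1/2) * (1 + w * w))"
  have z_rec: "z 0 = 0" "z (Suc n) = (1/2) *\<^sub>R (x + z n * z n)" for n
    by (simp_all add: z_def)
  have r_rec: "r 0 = 0" "r (Suc n) = (1/2) * (1 + r n * r n)" for n
    by (simp_all add: r_def)
  have r: "0 \<le> r n \<and> r n \<le> 1" for n
    by (induction n) (auto simp: r_rec mult_le_one)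
  have z_norm: "norm (z n) \<le> r n" for n
  proof (induction n)
    case (Suc n)
    have "norm (z n * z n) \<le> r n * r n"
      using Suc r[of n] by (intro order_trans[OF norm_mult_ineq] mult_mono) auto
    then have "norm (x + z n * z n) \<le> 1 + r n * r n"
      using norm_triangle_ineq[of x "z n * z n"] x by linarith
    then show ?case by (simp add: z_rec r_rec)
  qed (simp add: z_rec r_rec)
  have z_sa: "star (z n) = z n" for n
    by (induction n) (simp_all add: z_rec star_scaleR star_add star_mult sa)
  have diff: "norm (z (Suc n) - z n) \<le> r (Suc n) - r n" for n
  proof (induction n)
    case 0
    then show ?case using x by (simp add: z_rec r_rec)
  next
    case (Suc n)
    have "z (Suc (Suc n)) - z (Suc n) = (1/2) *\<^sub>R ((x + z (Suc n) * z (Suc n)) - (x + z n * z n))"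
      by (simp only: z_rec(2)[of "Suc n"] z_rec(2)[of n] scaleR_diff_right)
    also have "\<dots> = (1/2) *\<^sub>R ((z (Suc n) - z n) * (z (Suc n) + z n))"
      by (simp add: algebra_simps)
    finally have "norm (z (Suc (Suc n)) - z (Suc n)) = norm ((z (Suc n) - z n) * (z (Suc n) + z n)) / 2"
      by simp
    also have "\<dots> \<le> (r (Suc n) - r n) * (r (Suc n) + r n) / 2"
      using Suc order_trans[OF norm_ge_zero Suc] z_norm[of n] z_norm[of "Suc n"] norm_triangle_ineq[of "z (Suc n)" "z n"]
      by (intro divide_right_mono order_trans[OF norm_mult_ineq] mult_mono) auto
    also have "\<dots> = r (Suc (Suc n)) - r (Suc n)"
      by (simp only: r_rec(2)[of "Suc n"] r_rec(2)[of n]) (simp add: field_simps)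
    finally show ?case .
  qed
  \<comment> \<open>Monotonicity of \<open>r\<close> comes for free, since its increments dominate
    norms.\<close>
  have "r n \<le> r (Suc n)" for n
    using diff[of n] norm_ge_zero[of "z (Suc n) - z n"] by linarith
  then obtain L where "r \<longlonglongrightarrow> L"
    by (metis incseq_SucI incseq_convergent r)
  then have "summable (\<lambda>n. r (Suc n) - r n)"
    by (rule telescope_summable)
  then have "summable (\<lambda>n. z (Suc n) - z n)"
    by (rule summable_comparison_test'[where N = 0]) (rule diff)
  then obtain l where "(\<lambda>n. \<Sum>k<n. z (Suc k) - z k) \<longlonglongrightarrow> l"
    by (auto simp: summable_def sums_def)
  then have lim: "z \<longlonglongrightarrow> l"
    by (simp only: sum_lessThan_telescope) (simp add: z_rec)
  show thesis
  proof
    show "star l = l"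
      using bounded_linear.tendsto[OF bounded_linear_star lim] lim
      by (simp add: z_sa LIMSEQ_unique)
    show "norm l \<le> 1"
      by (rule LIMSEQ_le_const2[OF tendsto_norm[OF lim]]) (meson r z_norm order_trans)
    have "(\<lambda>n. z (Suc n)) \<longlonglongrightarrow> (1/2) *\<^sub>R (x + l * l)"
      unfolding z_rec by (intro tendsto_intros lim)
    then have "(1/2) *\<^sub>R (x + l * l) = l"
      using LIMSEQ_Suc[OF lim] LIMSEQ_unique by blast
    then have "x + l * l = l + l"
      by (metis scaleR_2 scaleR_half_double scaleR_right_distrib)
    then show "(1 - l) * (1 - l) = 1 - x" by (simp add: algebra_simps)
  qed
qed

text \<open>Encoding positivity as being a self-adjoint square avoids the spectrum. Products are
  then immediate by commutativity, and closure under sums is the part that needs work.\<close>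

definition nonneg :: "'a::comm_cstar_algebra \<Rightarrow> bool"
  where "nonneg a \<longleftrightarrow> (\<exists>c. star c = c \<and> a = c * c)"

lemma nonneg_star: "nonneg a \<Longrightarrow> star a = a"
  by (auto simp: nonneg_def star_mult)

lemma nonneg_square: "star c = c \<Longrightarrow> nonneg (c * c)"
  by (auto simp: nonneg_def)

lemma nonneg_mult: "nonneg a \<Longrightarrow> nonneg b \<Longrightarrow> nonneg (a * b)"
proof -
  assume "nonneg a" "nonneg b"
  then obtain c d where "star c = c" "a = c * c" "star d = d" "b = d * d"
    by (auto simp: nonneg_def)
  then show ?thesis
    unfolding nonneg_def by (intro exI[of _ "c * d"]) (auto simp: star_mult algebra_simps)
qed

lemma nonneg_of_real: "0 \<le> r \<Longrightarrow> nonneg (of_real r)"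
  using nonneg_square[of "of_real (sqrt r)"] by (simp flip: of_real_mult)

lemma nonneg_0 [simp]: "nonneg 0" and nonneg_1 [simp]: "nonneg 1"
  using nonneg_of_real[of 0] nonneg_of_real[of 1] by auto

lemma nonneg_power: "nonneg a \<Longrightarrow> nonneg (a ^ n)"
  by (induction n) (auto intro: nonneg_mult)

text \<open>For self-adjoint \<open>a\<close> the norm condition places the spectrum between
  \<open>0\<close> and \<open>2 * t\<close>. Dividing by \<open>t\<close> brings
  \<open>1 - a / t\<close> into the unit ball, where the iteration applies; the root of
  \<open>a / t\<close> is \<open>1 - z\<close>.\<close>

lemma nonneg_sqrt_bound:
  fixes a :: "'a::comm_cstar_algebra"
  assumes "star a = a" "norm (of_real t - a) \<le> t"
  obtains z where "star z = z" "norm z \<le> 1" "of_real t * ((1 - z) * (1 - z)) = a"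
proof (cases "t = 0")
  case True
  then show thesis using assms that[of 0] by simp
next
  case False
  then have t: "0 < t" using norm_ge_zero[of "of_real t - a"] assms(2) by linarith
  let ?x = "1 - of_real (1/t) * a"
  have x: "?x = of_real (1/t) * (of_real t - a)"
    using t by (simp add: algebra_simps flip: of_real_mult)
  have "norm ?x = norm (of_real t - a) / t"
    unfolding x using t by (simp add: of_real_def)
  then have "norm ?x \<le> 1" using assms(2) t by simp
  moreover have "star ?x = ?x" by (simp add: star_diff star_mult assms(1) mult.commute)
  ultimately obtain z where "star z = z" "norm z \<le> 1" "(1 - z) * (1 - z) = 1 - ?x"
    using sqrt_one_minus by blast
  then show thesis using that[of z] t by (simp add: mult.assoc[symmetric] flip: of_real_mult)
qed

text \<open>A metric test for positivity, through which the triangle inequality and limits reach the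
  cone.\<close>

lemma nonnegI_norm:
  assumes "star a = a" "norm (of_real t - a) \<le> t"
  shows "nonneg a"
proof -
  obtain z where z: "star z = z" "norm z \<le> 1" "of_real t * ((1 - z) * (1 - z)) = a"
    using nonneg_sqrt_bound assms .
  have "0 \<le> t" using assms(2) norm_ge_zero order_trans by blast
  then show ?thesis
    using z nonneg_mult[OF nonneg_of_real nonneg_square[of "1 - z"], of t] by (simp add: star_diff)
qed

lemma nonneg_of_real_diff:
  assumes "star a = a" "norm a \<le> t"
  shows "nonneg (of_real t - a)" "nonneg (of_real t + a)"
  using assms by (auto intro!: nonnegI_norm[where t = t] simp: star_diff star_add)

text \<open>A converse to \<open>nonnegI_norm\<close>: the difference is itself a square
  \<open>d * d\<close>, and \<open>norm_square_le\<close> compares it with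
  \<open>d * d + c * c = of_real t\<close>.\<close>

lemma norm_of_real_diff_square:
  fixes c :: "'a::comm_cstar_algebra"
  assumes c: "star c = c" and t: "(norm c)\<^sup>2 \<le> t"
  shows "norm (of_real t - c * c) \<le> t"
proof -
  have t0: "0 \<le> t" using t by (meson order_trans zero_le_power2)
  have "norm (c * c) \<le> t"
    using norm_mult_ineq[of c c] t by (simp add: power2_eq_square)
  then have "nonneg (of_real t - c * c)"
    using c by (intro nonneg_of_real_diff) (auto simp: star_mult)
  then obtain d where d: "star d = d" "of_real t - c * c = d * d"
    by (auto simp: nonneg_def)
  have "norm (d * d) \<le> norm (d * d + c * c)" by (rule norm_square_le) (auto simp: c d)
  also have "d * d + c * c = of_real t" by (simp flip: d(2))
  finally show ?thesis using t0 d by simp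
qed

lemma nonneg_add:
  assumes "nonneg a" "nonneg b"
  shows "nonneg (a + b)"
proof -
  obtain c d where cd: "star c = c" "a = c * c" "star d = d" "b = d * d"
    using assms by (auto simp: nonneg_def)
  let ?t = "(norm c)\<^sup>2 + (norm d)\<^sup>2"
  show ?thesis
  proof (rule nonnegI_norm[where t = "?t + ?t"])
    have "of_real (?t + ?t) - (a + b) = (of_real ?t - c * c) + (of_real ?t - d * d)"
      by (simp add: cd)
    moreover have "norm (of_real ?t - c * c) \<le> ?t" "norm (of_real ?t - d * d) \<le> ?t"
      by (rule norm_of_real_diff_square; simp add: cd)+
    ultimately show "norm (of_real (?t + ?t) - (a + b)) \<le> ?t + ?t"
      by (metis norm_triangle_mono)
  qed (simp add: cd star_add star_mult)
qed

lemma nonneg_diff_trans: "nonneg (b - a) \<Longrightarrow> nonneg (c - b) \<Longrightarrow> nonneg (c - a)"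
  using nonneg_add[of "b - a" "c - b"] by simp

lemma nonneg_sum: "(\<And>i. i \<in> I \<Longrightarrow> nonneg (f i)) \<Longrightarrow> nonneg (sum f I)"
  by (induction I rule: infinite_finite_induct) (auto intro: nonneg_add)

text \<open>Among self-adjoint elements, balls become order intervals. For the backward direction,
  the product of the two positive elements is \<open>t\<^sup>2 - a * a\<close> and again a square,
  so \<open>norm_square_le\<close> bounds \<open>a * a\<close>.\<close>

lemma norm_le_iff_nonneg:
  fixes a :: "'a::comm_cstar_algebra"
  assumes a: "star a = a" and t: "0 \<le> t"
  shows "norm a \<le> t \<longleftrightarrow> nonneg (of_real t - a) \<and> nonneg (of_real t + a)"
proof (intro iffI conjI; (elim conjE)?)
  assume "nonneg (of_real t - a)" "nonneg (of_real t + a)"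
  then have "nonneg ((of_real t - a) * (of_real t + a))" by (rule nonneg_mult)
  then obtain c where c: "star c = c" "(of_real t - a) * (of_real t + a) = c * c"
    by (auto simp: nonneg_def)
  have "norm (a * a) \<le> norm (a * a + c * c)" by (rule norm_square_le) (auto simp: a c)
  also have "a * a + c * c = of_real (t\<^sup>2)"
    unfolding c(2)[symmetric] by (simp add: algebra_simps power2_eq_square)
  also have "norm (of_real (t\<^sup>2) :: 'a) = t\<^sup>2" by (simp only: norm_of_real) simp
  finally have "(norm a)\<^sup>2 \<le> t\<^sup>2" using cstar_identity[of a] a by simp
  then show "norm a \<le> t" using t by (rule power2_le_imp_le)
qed (use nonneg_of_real_diff a in auto)

lemma nonneg_antisym:
  assumes "nonneg a" "nonneg (- a)"
  shows "a = 0"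
  using norm_le_iff_nonneg[of a 0] nonneg_star[OF assms(1)] assms by simp

text \<open>The cone is closed because its metric test is: with \<open>t = norm a\<close>, the
  distance from \<open>a\<close> to \<open>of_real t\<close> is at most \<open>t + e\<close> for
  every \<open>e\<close>, hence at most \<open>t\<close>.\<close>

lemma nonneg_approx:
  assumes "\<And>e. 0 < e \<Longrightarrow> nonneg (of_real e + a)"
  shows "nonneg a"
proof -
  have "star (of_real 1 + a) = of_real 1 + a" by (rule nonneg_star, rule assms) simp
  then have a: "star a = a" by (simp add: star_add)
  let ?t = "norm a"
  have "norm (of_real ?t - a) \<le> ?t + e" if "0 < e" for e
  proof -
    have "star (of_real ?t - a) = of_real ?t - a" by (simp add: a star_diff)
    moreover have "nonneg (of_real (?t + e) - (of_real ?t - a))"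
      using assms[OF that] by simp
    moreover have "nonneg (of_real (?t + e) + (of_real ?t - a))"
      using nonneg_add[OF nonneg_of_real[of "?t + e"] nonneg_of_real_diff(1)[OF a order_refl]] that
      by simp
    ultimately show ?thesis
      using norm_le_iff_nonneg[of "of_real ?t - a" "?t + e"] that by simp
  qed
  then have "norm (of_real ?t - a) \<le> ?t" by (rule field_le_epsilon)
  then show ?thesis by (rule nonnegI_norm[OF a])
qed

text \<open>The definition of \<open>nonneg\<close> only supplies a self-adjoint root; a positive
  one comes from the iteration, scaled by the norm of the first.\<close>

lemma nonneg_sqrt:
  assumes "nonneg a"
  obtains c where "nonneg c" "c * c = a"
proof -
  obtain d where d: "star d = d" "a = d * d" using assms by (auto simp: nonneg_def)
  let ?t = "(norm d)\<^sup>2"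
  obtain z where z: "star z = z" "norm z \<le> 1" "of_real ?t * ((1 - z) * (1 - z)) = a"
    using nonneg_sqrt_bound[OF nonneg_star[OF assms], of ?t] norm_of_real_diff_square[OF d(1), of ?t] d
    by auto
  show thesis
  proof
    have "nonneg (1 - z)" using nonneg_of_real_diff(1)[of z 1] z by simp
    then show "nonneg (of_real (norm d) * (1 - z))" by (intro nonneg_mult nonneg_of_real) auto
    show "(of_real (norm d) * (1 - z)) * (of_real (norm d) * (1 - z)) = a"
      unfolding z(3)[symmetric] by (simp add: power2_eq_square algebra_simps)
  qed
qed

section \<open>Projections in commutative W*-algebras\<close>

text \<open>Weak-star compactness of balls, obtained by viewing elements as functions on the predual
  with the topology of pointwise convergence.\<close>

lemma wstar_ball_intersection:
  fixes D :: "'a::cstar_algebra \<Rightarrow> 'e::complex_banach \<Rightarrow> complex"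
    and C :: "'a set"
  assumes D: "wstar_predual D"
    and fin: "\<And>A. finite A \<Longrightarrow> A \<subseteq> C \<Longrightarrow> \<exists>y. \<forall>c\<in>A. norm (y - c) \<le> r"
  shows "\<exists>y. \<forall>c\<in>C. norm (y - c) \<le> r"
proof (cases "C = {}")
  case False
  then obtain c0 where c0: "c0 \<in> C" by blast
  have D_add: "D (a + b) x = D a x + D b x" and D_lin: "bounded_clinear (D a)"
    and D_norm: "onorm (D a) = norm a" for a b x
    using D by (auto simp: wstar_predual_def)
  have D_diff: "D (a - b) x = D a x - D b x" for a b x
    using D_add[of "a - b" b x] by simp
  \<comment> \<open>\<open>B c\<close> admits nonlinear functions, which makes it a product of
    closed discs and so compact by Tychonoff; linearity is imposed separately by the closed set
    \<open>L\<close>.\<close>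
  define B where "B c = {f. \<forall>x. cmod (f x - D c x) \<le> r * norm x}" for c
  have B_mem: "D y \<in> B c \<longleftrightarrow> norm (y - c) \<le> r" if "0 \<le> r" for y c
  proof
    have bl: "bounded_linear (D (y - c))" using D_lin by (simp add: bounded_clinear_def)
    show "norm (y - c) \<le> r" if "D y \<in> B c"
      using that \<open>0 \<le> r\<close> unfolding D_norm[symmetric]
      by (intro onorm_bound) (auto simp: B_def D_diff)
    show "D y \<in> B c" if "norm (y - c) \<le> r"
      unfolding B_def
    proof clarify
      fix x
      have "cmod (D y x - D c x) \<le> norm (y - c) * norm x"
        using onorm[OF bl, of x] by (simp add: D_diff D_norm)
      also have "\<dots> \<le> r * norm x" using that by (rule mult_right_mono) simp
      finally show "cmod (D y x - D c x) \<le> r * norm x" .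
    qed
  qed
  have r: "0 \<le> r"
    using fin[of "{c0}"] c0 by (auto intro: order_trans[OF norm_ge_zero])
  define L where "L = {f :: 'e \<Rightarrow> complex. (\<forall>x y. f (x + y) = f x + f y) \<and> (\<forall>c x. f (c *\<^sub>C x) = c * f x)}"
  have B_closed: "closed (B c)" for c
    unfolding B_def
    by (intro closed_Collect_all closed_Collect_le continuous_intros continuous_on_product_coordinates)
  have L_closed: "closed L"
    unfolding L_def
    by (intro closed_Collect_all closed_Collect_conj closed_Collect_eq continuous_intros
        continuous_on_product_coordinates)
  have B_PiE: "B c0 = PiE UNIV (\<lambda>x. cball (D c0 x) (r * norm x))"
    by (auto simp: B_def PiE_def dist_norm norm_minus_commute)
  have "compactin (product_topology (\<lambda>_. euclidean) UNIV) (B c0)"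
    unfolding B_PiE compactin_PiE by simp
  then have "compact (B c0)" by (simp add: euclidean_product_topology)
  then have "compact (B c0 \<inter> L)" using L_closed by (rule compact_Int_closed)
  moreover have "B c0 \<inter> L \<inter> (\<Inter>c\<in>A. B c) \<noteq> {}" if A: "finite A" "A \<subseteq> C" for A
  proof -
    obtain y where y: "\<forall>c\<in>insert c0 A. norm (y - c) \<le> r"
      using fin[of "insert c0 A"] A c0 by auto
    have "D y \<in> L"
      using D_lin[of y] by (auto simp: bounded_clinear_def L_def scaleC_complex_def linear_simps)
    then have "D y \<in> B c0 \<inter> L \<inter> (\<Inter>c\<in>A. B c)" using y B_mem[OF r] by auto
    then show ?thesis by blast
  qed
  ultimately have "B c0 \<inter> L \<inter> (\<Inter>c\<in>C. B c) \<noteq> {}"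
    by (rule compact_imp_fip_image[OF _ B_closed])
  then obtain f where f: "f \<in> L" "\<And>c. c \<in> C \<Longrightarrow> f \<in> B c" by blast
  \<comment> \<open>Staying within distance \<open>r\<close> of \<open>D c0\<close> bounds
    \<open>f\<close>, and surjectivity of \<open>D\<close> onto the bounded functionals then returns
    an element of the algebra.\<close>
  have "bounded_linear f"
  proof (rule bounded_linear_intro)
    show "f (x + y) = f x + f y" for x y using f(1) by (simp add: L_def)
    show "f (a *\<^sub>R x) = a *\<^sub>R f x" for a x
    proof -
      have "f (complex_of_real a *\<^sub>C x) = a *\<^sub>R f x"
        using f(1) by (simp add: L_def scaleR_conv_of_real)
      then show ?thesis by (simp add: scaleC_of_real)
    qed
    fix x
    have "cmod (f x - D c0 x) \<le> r * norm x" using f(2)[OF c0] by (simp add: B_def)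
    moreover have "cmod (D c0 x) \<le> norm c0 * norm x"
      using onorm[of "D c0" x] D_lin[of c0] by (simp add: D_norm bounded_clinear_def)
    ultimately show "norm (f x) \<le> norm x * (r + norm c0)"
      using norm_triangle_ineq[of "f x - D c0 x" "D c0 x"] by (simp add: algebra_simps)
  qed
  then have "bounded_clinear f" using f(1) by (simp add: bounded_clinear_def L_def scaleC_complex_def)
  then have "f \<in> range D" using D by (simp add: wstar_predual_def)
  then obtain y where "f = D y" by blast
  then show ?thesis using f(2) B_mem[OF r] by blast
qed simp

lemma nonneg_one_minus_power:
  assumes "nonneg w" "nonneg (1 - w)"
  shows "nonneg (1 - w ^ n)"
proof (induction n)
  case (Suc n)
  have "1 - w ^ Suc n = (1 - w) + w * (1 - w ^ n)" by (simp add: algebra_simps)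
  then show ?case using assms Suc by (metis nonneg_add nonneg_mult)
qed simp

text \<open>
  Powers of \<open>w\<close> are upper bounds of the set in question; they force a common point of the balls to
  satisfy \<open>p w = p\<close>, so that no inverses are needed.
\<close>

lemma wstar_greatest_fixed_by:
  fixes D :: "'a::comm_cstar_algebra \<Rightarrow> 'e::complex_banach \<Rightarrow> complex"
    and w :: 'a
  assumes D: "wstar_predual D" and w: "nonneg w" "nonneg (1 - w)"
  obtains p where "nonneg p" "nonneg (1 - p)" "p * w = p"
    "\<And>x. nonneg x \<Longrightarrow> nonneg (1 - x) \<Longrightarrow> x * w = x \<Longrightarrow> nonneg (p - x)"
proof -
  define S where "S = {x. nonneg x \<and> nonneg (1 - x) \<and> x * w = x}"
  have S0: "0 \<in> S" by (simp add: S_def)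
  have directed: "\<exists>y\<in>S. \<forall>x\<in>A. nonneg (y - x)" if "finite A" "A \<subseteq> S" for A
    using that
  proof (induction A rule: finite_induct)
    case empty
    then show ?case using S0 by auto
  next
    case (insert a A)
    then obtain y where y: "y \<in> S" "\<forall>x\<in>A. nonneg (y - x)" by auto
    have a: "a \<in> S" using insert by simp
    \<comment> \<open>The analogue of a union of two sets: \<open>1 - ?u\<close> is the product of
      the complements.\<close>
    let ?u = "a + y - a * y"
    have "?u = a + (1 - a) * y" "1 - ?u = (1 - a) * (1 - y)" "?u - y = a * (1 - y)"
      "?u - a = (1 - a) * y"
      by (simp_all add: algebra_simps)
    then have u: "nonneg ?u" "nonneg (1 - ?u)" "nonneg (?u - y)" "nonneg (?u - a)"
      using a y(1) unfolding S_def mem_Collect_eq by (metis nonneg_add nonneg_mult)+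
    have "?u * w = a * w + y * w - a * (y * w)" by (simp add: algebra_simps)
    then have "?u \<in> S" using u a y(1) by (simp add: S_def)
    moreover have "nonneg (?u - x)" if "x \<in> insert a A" for x
      using that u y(2) nonneg_diff_trans[of y x ?u] by auto
    ultimately show ?case by blast
  qed
  \<comment> \<open>Among self-adjoint elements, the unit ball at \<open>x + 1\<close> is the
    interval from \<open>x\<close> to \<open>x + 2\<close>, and the one at \<open>w ^ n - 1\<close>
    is the interval from \<open>w ^ n - 2\<close> to \<open>w ^ n\<close>. A common point thus lies
    above all of \<open>S\<close> and below all powers of \<open>w\<close>.\<close>
  define C where "C = (\<lambda>x. x + 1) ` S \<union> range (\<lambda>n. w ^ n - 1)"
  have sa: "star c = c" if "c \<in> C" for c
    using that nonneg_star[OF nonneg_power[OF w(1)]] nonneg_star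
    by (auto simp: C_def S_def star_add star_diff)
  have "\<exists>y. \<forall>c\<in>A. norm (y - c) \<le> 1" if A: "finite A" "A \<subseteq> C" for A
  proof -
    have "finite ((\<lambda>c. c - 1) ` A \<inter> S)" using A by simp
    then obtain y where y: "y \<in> S" "\<And>x. x \<in> (\<lambda>c. c - 1) ` A \<inter> S \<Longrightarrow> nonneg (y - x)"
      using directed[of "(\<lambda>c. c - 1) ` A \<inter> S"] by auto
    have y01: "nonneg y" "nonneg (1 - y)" "y * w = y" using y(1) by (auto simp: S_def)
    have yw: "y * w ^ n = y" for n
      by (induction n) (simp_all add: y01(3) mult.assoc[symmetric])
    have "norm (y - c) \<le> 1" if c: "c \<in> A" for c
    proof -
      have "star (y - c) = y - c"
        using sa c A(2) nonneg_star[OF y01(1)] by (auto simp: star_diff)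
      moreover have "nonneg (1 - (y - c)) \<and> nonneg (1 + (y - c))"
      proof -
        consider x where "x \<in> S" "c = x + 1" | n where "c = w ^ n - 1"
          using c A(2) by (auto simp: C_def)
        then show ?thesis
        proof cases
          case 1
          have "x \<in> (\<lambda>c. c - 1) ` A \<inter> S" using 1 c by force
          then have "nonneg (y - x)" by (rule y(2))
          moreover have "nonneg ((1 - y) + (x + 1))"
            using y01 1(1) unfolding S_def by (intro nonneg_add) auto
          moreover have "1 - (y - c) = (1 - y) + (x + 1)" "1 + (y - c) = y - x"
            by (simp_all add: 1)
          ultimately show ?thesis by metis
        next
          case 2
          have "1 - (y - c) = w ^ n * (1 - y)"
            using yw[of n] by (simp add: 2 algebra_simps)
          moreover have "1 + (y - c) = y + ((1 - w ^ n) + 1)" by (simp add: 2)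
          moreover have "nonneg (w ^ n * (1 - y))"
            by (intro nonneg_mult nonneg_power w y01)
          moreover have "nonneg (y + ((1 - w ^ n) + 1))"
            by (intro nonneg_add nonneg_one_minus_power nonneg_1 w y01)
          ultimately show ?thesis by metis
        qed
      qed
      ultimately show ?thesis using norm_le_iff_nonneg[of "y - c" 1] by simp
    qed
    then show ?thesis by blast
  qed
  then obtain q where q: "\<forall>c\<in>C. norm (q - c) \<le> 1"
    using wstar_ball_intersection[OF D, of C 1] by blast
  \<comment> \<open>The centres are self-adjoint, so the real part of \<open>q\<close> lies in the same balls.\<close>
  define p where "p = (1/2) *\<^sub>R (q + star q)"
  have p: "star p = p" by (simp add: p_def star_scaleR star_add star_star add.commute)
  have pc: "nonneg (1 - (p - c))" "nonneg (1 + (p - c))" if c: "c \<in> C" for c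
  proof -
    have "2 *\<^sub>R (p - c) = (q - c) + star (q - c)"
      by (simp add: p_def scaleR_diff_right star_diff sa[OF c] scaleR_2)
    then have "2 * norm (p - c) = norm ((q - c) + star (q - c))"
      by (metis abs_numeral norm_scaleR)
    also have "\<dots> \<le> 1 + 1"
      using q c by (intro norm_triangle_mono) (auto simp: norm_star)
    finally have "norm (p - c) \<le> 1" by simp
    then show "nonneg (1 - (p - c))" "nonneg (1 + (p - c))"
      using norm_le_iff_nonneg[of "p - c" 1] by (auto simp: star_diff p sa[OF c])
  qed
  have upper: "nonneg (p - x)" if "x \<in> S" for x
    using pc(2)[of "x + 1"] that by (simp add: C_def)
  have lower: "nonneg (w ^ n - p)" for n
    using pc(1)[of "w ^ n - 1"] by (simp add: C_def)
  have p0: "nonneg p" using upper[OF S0] by simp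
  \<comment> \<open>Since \<open>p \<le> w\<^sup>k\<close>, the telescoping sum of \<open>w\<^sup>k (1 - w)\<close> gives \<open>N p (1 - w) \<le> 1\<close> for all \<open>N\<close>.\<close>
  have "nonneg (- (p * (1 - w)))"
  proof (rule nonneg_approx)
    fix e :: real assume "0 < e"
    then obtain N where N: "inverse (of_nat (Suc N)) < e"
      using reals_Archimedean by blast
    let ?N = "Suc N"
    have "nonneg ((\<Sum>k<?N. (w ^ k - p) * (1 - w)) + w ^ ?N)"
      by (intro nonneg_add nonneg_sum nonneg_mult lower w nonneg_power)
    also have "(\<Sum>k<M. (w ^ k - p) * (1 - w)) = (1 - w ^ M) - of_nat M * (p * (1 - w))" for M
      by (induction M) (simp_all add: algebra_simps)
    finally have "nonneg (of_real (inverse ?N) * (1 - of_nat ?N * (p * (1 - w))))"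
      by (intro nonneg_mult nonneg_of_real) auto
    moreover have "of_real (inverse ?N) * of_nat ?N = (1 :: 'a)"
      by (metis of_nat_neq_0 of_real_1 of_real_mult of_real_of_nat_eq left_inverse of_nat_eq_0_iff)
    then have "of_real (inverse ?N) * (1 - of_nat ?N * (p * (1 - w)))
        = of_real (inverse ?N) - p * (1 - w)"
      by (simp only: right_diff_distrib mult.assoc[symmetric] mult_1_left mult_1_right)
    moreover have "nonneg (of_real (e - inverse ?N) :: 'a)"
      using N by (intro nonneg_of_real) simp
    ultimately have "nonneg ((of_real (inverse ?N) - p * (1 - w)) + of_real (e - inverse ?N))"
      by (metis nonneg_add)
    then show "nonneg (of_real e + - (p * (1 - w)))"
      by (simp only: of_real_diff) (simp add: algebra_simps)
  qed
  moreover have "nonneg (p * (1 - w))" using p0 w(2) by (rule nonneg_mult)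
  ultimately have "p * (1 - w) = 0" by (rule nonneg_antisym[rotated])
  then have "p * w = p" by (simp add: algebra_simps)
  \<comment> \<open>The power \<open>n = 0\<close> in \<open>lower\<close> gives
    \<open>nonneg (1 - p)\<close>.\<close>
  then show thesis using that[of p] p0 lower[of 0] upper by (auto simp: S_def)
qed

lemma wstar_separating_projection:
  fixes D :: "'a::comm_cstar_algebra \<Rightarrow> 'e::complex_banach \<Rightarrow> complex"
    and g h :: 'a
  assumes D: "wstar_predual D" and gh: "nonneg g" "nonneg h" "g * h = 0"
  obtains p where "is_projection p" "p * g = 0" "(1 - p) * h = 0"
proof -
  have scale: "\<exists>t>0. nonneg (of_real t * a) \<and> nonneg (1 - of_real t * a)" if "nonneg a" for a :: 'a
  proof -
    let ?t = "inverse (norm a + 1)"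
    have t: "?t > 0" by (simp add: add_nonneg_pos)
    have n: "nonneg (of_real ?t * a)" using that t by (intro nonneg_mult nonneg_of_real) auto
    have "norm (of_real ?t * a) = ?t * norm a"
      using t unfolding of_real_def by (simp add: abs_of_pos)
    also have "\<dots> \<le> 1" using t by (simp add: field_simps add_nonneg_pos)
    finally have "nonneg (1 - of_real ?t * a)"
      using nonneg_of_real_diff(1)[of "of_real ?t * a" 1] nonneg_star[OF n] by simp
    then show ?thesis using t n by blast
  qed
  obtain s where s: "0 < s" "nonneg (of_real s * g)" "nonneg (1 - of_real s * g)"
    using scale[OF gh(1)] by blast
  obtain t where t: "0 < t" "nonneg (of_real t * h)" "nonneg (1 - of_real t * h)"
    using scale[OF gh(2)] by blast
  \<comment> \<open>With \<open>w = 1 - of_real s * g\<close>, being fixed by \<open>w\<close> means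
    annihilating \<open>g\<close>.\<close>
  obtain p where p: "nonneg p" "nonneg (1 - p)" "p * (1 - of_real s * g) = p"
    and max: "\<And>x. nonneg x \<Longrightarrow> nonneg (1 - x) \<Longrightarrow> x * (1 - of_real s * g) = x \<Longrightarrow> nonneg (p - x)"
    using wstar_greatest_fixed_by[OF D s(3)] s(2) by auto
  have cancel: "x = 0" if "of_real r * x = 0" "0 < r" for r and x :: 'a
    using that by (simp add: of_real_def)
  have "of_real s * (p * g) = 0" using p(3) by (simp add: algebra_simps)
  then have pg: "p * g = 0" using s(1) by (rule cancel)
  have fixed: "x * (1 - of_real s * g) = x" if "x * g = 0" for x
  proof -
    have "x * (1 - of_real s * g) = x - of_real s * (x * g)" by (simp add: algebra_simps)
    then show ?thesis by (simp add: that)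
  qed
  have idem: "p * p = p"
  proof -
    \<comment> \<open>This candidate also annihilates \<open>g\<close> and lies between 0 and 1, so
      maximality of \<open>p\<close> forces the positive summand \<open>p * (1 - p)\<close> to
      vanish.\<close>
    let ?x = "p + p * (1 - p)"
    have "1 - ?x = (1 - p) * (1 - p)" by (simp add: algebra_simps)
    moreover have "?x * g = (2 - p) * (p * g)" by (simp add: algebra_simps)
    then have "?x * g = 0" by (simp add: pg)
    ultimately have "nonneg (p - ?x)"
      using p by (intro max fixed) (auto intro: nonneg_add nonneg_mult)
    then have "p * (1 - p) = 0"
      using p by (intro nonneg_antisym nonneg_mult) auto
    then show ?thesis by (simp add: algebra_simps)
  qed
  have ph: "(1 - p) * h = 0"
  proof -
    \<comment> \<open>Since \<open>g * h = 0\<close>, adding \<open>?y\<close> to \<open>p\<close>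
      stays inside the set of competitors, and maximality again makes the increment vanish.\<close>
    let ?y = "(1 - p) * (of_real t * h)"
    have y: "nonneg ?y" using p(2) t(2) by (rule nonneg_mult)
    have "nonneg ((1 - p) * (1 - of_real t * h))" by (intro nonneg_mult p t)
    moreover have "(1 - p) * (1 - of_real t * h) = 1 - (p + ?y)" by (simp add: algebra_simps)
    moreover have "(p + ?y) * g = p * g + (1 - p) * of_real t * (g * h)" by (simp add: algebra_simps)
    then have "(p + ?y) * g = 0" by (simp add: pg gh(3))
    ultimately have "nonneg (p - (p + ?y))"
      using p(1) y by (intro max fixed) (auto intro: nonneg_add)
    then have "?y = 0" using y by (intro nonneg_antisym) auto
    then have "of_real t * ((1 - p) * h) = 0" by (simp add: algebra_simps)
    then show ?thesis using t(1) by (rule cancel)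
  qed
  show thesis
    using that[of p] nonneg_star[OF p(1)] idem pg ph by (auto simp: is_projection_def)
qed

text \<open>With the symmetry \<open>s = 2 p - 1\<close> and the absolute value \<open>c\<close> one
  has \<open>a = s c\<close>, so \<open>2 a - s = s (2 c - 1)\<close>. The second factor has norm at
  most 1 because \<open>c\<close> lies between 0 and 1.\<close>

lemma wstar_symmetry_approx:
  fixes D :: "'a::comm_cstar_algebra \<Rightarrow> 'e::complex_banach \<Rightarrow> complex"
    and a :: 'a
  assumes D: "wstar_predual D" and a: "star a = a" "norm a \<le> 1"
  obtains p where "is_projection p" "norm (2 *\<^sub>R a - (2 *\<^sub>R p - 1)) \<le> 1"
proof -
  obtain c where c: "nonneg c" "c * c = a * a" using nonneg_sqrt[OF nonneg_square[OF a(1)]] .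
  \<comment> \<open>\<open>c\<close> is the absolute value of \<open>a\<close>; squaring avoids proving \<open>c - a, c + a \<ge> 0\<close>.\<close>
  define u v where "u = c - a" and "v = c + a"
  have sa: "star u = u" "star v = v"
    using a nonneg_star[OF c(1)] by (auto simp: u_def v_def star_diff star_add)
  have "u * v = 0" using c(2) by (simp add: u_def v_def algebra_simps)
  then have "(u * u) * (v * v) = 0" by (metis mult.assoc mult.commute mult_zero_right)
  then obtain p where p: "is_projection p" "p * (u * u) = 0" "(1 - p) * (v * v) = 0"
    using wstar_separating_projection[OF D nonneg_square[OF sa(1)] nonneg_square[OF sa(2)]] by auto
  have pp: "star p = p" "p * p = p" using p(1) by (auto simp: is_projection_def)
  have kill: "q * x = 0" if "star q = q" "star x = x" "q * (x * x) = 0" for q x :: 'a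
  proof -
    have "star (q * x) * (q * x) = q * (q * (x * x))" using that by (simp add: star_mult algebra_simps)
    then have "(norm (q * x))\<^sup>2 = 0" using cstar_identity[of "q * x"] that(3) by simp
    then show ?thesis by simp
  qed
  have pu: "p * u = 0" using kill pp sa p by blast
  have pv: "(1 - p) * v = 0" using kill[of "1 - p" v] pp sa p by (simp add: star_diff)
  define s where "s = p + p - 1"
  have "s * s = 4 * (p * p) - 4 * p + 1" by (simp add: s_def algebra_simps)
  then have s: "star s = s" "s * s = 1"
    by (simp_all add: pp, simp only: s_def star_diff star_add star_one pp)
  \<comment> \<open>On \<open>p\<close> the elements \<open>a\<close> and \<open>c\<close> agree,
    and on \<open>1 - p\<close> they are opposite.\<close>
  have "p * c = p * a" using pu by (simp add: u_def algebra_simps)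
  moreover have "c - p * c = p * a - a" using pv by (simp add: v_def algebra_simps)
  ultimately have "s * a = c" by (simp add: s_def algebra_simps)
  then have a_eq: "a = s * c" using s(2) by (metis mult.assoc mult_1_left)
  have "(norm c)\<^sup>2 = (norm a)\<^sup>2"
    using cstar_identity[of c] cstar_identity[of a] nonneg_star[OF c(1)] a(1) c(2) by simp
  then have c1: "norm c \<le> 1" using a(2) by simp
  have "norm (c + c - 1) \<le> 1"
  proof -
    have "nonneg (1 - c)" using nonneg_of_real_diff(1)[of c 1] c1 nonneg_star[OF c(1)] by simp
    then have "nonneg (1 - (c + c - 1))" "nonneg (1 + (c + c - 1))"
      using nonneg_add[of "1 - c" "1 - c"] nonneg_add[OF c(1) c(1)] by (simp_all add: algebra_simps)
    moreover have "star (c + c - 1) = c + c - 1"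
      by (simp only: star_diff star_add star_one nonneg_star[OF c(1)])
    ultimately show ?thesis
      using norm_le_iff_nonneg[of "c + c - 1" 1] by simp
  qed
  moreover have "norm s = 1" using cstar_identity[of s] s norm_ge_zero[of s] by (simp add: power2_eq_1_iff)
  ultimately have "norm (s * (c + c - 1)) \<le> 1"
    using norm_mult_ineq[of s "c + c - 1"] by simp
  moreover have "s * (c + c - 1) = 2 *\<^sub>R a - (2 *\<^sub>R p - 1)"
    by (subst a_eq) (simp add: s_def scaleR_2 algebra_simps)
  ultimately show thesis using that[OF p(1)] by simp
qed

text \<open>As \<open>f\<close> vanishes on \<open>p\<close> and on 1, replacing \<open>a\<close> by
  \<open>2 a - (2 p - 1)\<close> doubles \<open>f a\<close> while staying in the unit ball.
  Repetition bounds \<open>f a\<close> by \<open>K / 2 ^ n\<close> without forming the series; real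
  and imaginary parts give the general case.\<close>

lemma bounded_clinear_0_if_0_on_projections:
  fixes D :: "'a::comm_cstar_algebra \<Rightarrow> 'e::complex_banach \<Rightarrow> complex"
    and f :: "'a \<Rightarrow> 'b::complex_normed_vector"
  assumes D: "wstar_predual D" and f: "bounded_clinear f"
    and proj: "\<And>p. is_projection p \<Longrightarrow> f p = 0"
  shows "f a = 0"
proof -
  have bl: "bounded_linear f" and scaleC: "f (c *\<^sub>C x) = c *\<^sub>C f x" for c x
    using f by (auto simp: bounded_clinear_def)
  note lin = linear_simps[OF bl]
  obtain K where K: "\<And>x. norm (f x) \<le> norm x * K" and K0: "0 < K"
    using bounded_linear.pos_bounded[OF bl] by blast
  have f1: "f 1 = 0" by (rule proj) (simp add: is_projection_def)
  have unit: "norm (f a) \<le> K / 2 ^ n" if "star a = a" "norm a \<le> 1" for a n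
    using that
  proof (induction n arbitrary: a)
    case 0
    have "norm a * K \<le> 1 * K" using 0 K0 by (intro mult_right_mono) auto
    then show ?case using K[of a] by simp
  next
    case (Suc n)
    obtain p where p: "is_projection p" "norm (2 *\<^sub>R a - (2 *\<^sub>R p - 1)) \<le> 1"
      using wstar_symmetry_approx[OF D Suc.prems] .
    let ?b = "2 *\<^sub>R a - (2 *\<^sub>R p - 1)"
    have "star ?b = ?b" using p(1) Suc.prems(1) by (simp add: star_diff star_scaleR is_projection_def)
    then have "norm (f ?b) \<le> K / 2 ^ n" using p(2) by (rule Suc.IH)
    moreover have "f ?b = 2 *\<^sub>R f a" by (simp add: lin proj[OF p(1)] f1)
    ultimately show ?case by simp
  qed
  have sa: "f a = 0" if a: "star a = a" for a
  proof -
    let ?b = "inverse (norm a + 1) *\<^sub>R a"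
    have b: "star ?b = ?b" using a by (simp add: star_scaleR)
    have "0 < norm a + 1" by (simp add: add_nonneg_pos)
    then have "norm ?b \<le> 1" by (simp add: field_simps)
    then have le: "norm (f ?b) \<le> K / 2 ^ n" for n by (rule unit[OF b])
    have "(\<lambda>n. K * (1/2) ^ n) \<longlonglongrightarrow> K * 0"
      by (intro tendsto_mult_left LIMSEQ_power_zero) simp
    then have "norm (f ?b) \<le> K * 0"
      by (rule LIMSEQ_le_const) (use le in \<open>auto simp: power_divide\<close>)
    then have "f ?b = 0" by (simp only: mult_zero_right norm_le_zero_iff)
    then have "inverse (norm a + 1) *\<^sub>R f a = 0" by (simp only: lin)
    moreover have "norm a + 1 \<noteq> 0" using norm_ge_zero[of a] by linarith
    ultimately show ?thesis by simp
  qed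
  have "f (a + star a) = 0" by (rule sa) (simp add: star_add star_star add.commute)
  moreover have "f (\<i> *\<^sub>C (a - star a)) = 0"
  proof (rule sa)
    have "(- \<i>) *\<^sub>C (star a - a) = \<i> *\<^sub>C (a - star a)"
      using scaleC_scaleC[of \<i> "-1" "star a - a"] scaleC_of_real[of "-1" "star a - a"] by simp
    then show "star (\<i> *\<^sub>C (a - star a)) = \<i> *\<^sub>C (a - star a)"
      by (simp add: star_scaleC star_diff star_star)
  qed
  then have "\<i> *\<^sub>C f (a - star a) = 0" by (simp add: scaleC)
  then have "f (a - star a) = 0"
    using norm_scaleC[of \<i> "f (a - star a)"] by simp
  ultimately have "f a + f a = 0" by (simp add: lin)
  then show ?thesis by (simp add: scaleR_2[symmetric])
qed

section \<open>Orthogonal vector fields\<close>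

lemma scaleC_0_left [simp]: "0 *\<^sub>C (x::'a::complex_normed_vector) = 0"
  using scaleC_of_real[of 0 x] by simp

lemma scaleC_minus_left: "(- c) *\<^sub>C (x::'a::complex_normed_vector) = - (c *\<^sub>C x)"
  using scaleC_add_left[of c "- c" x] by (simp add: add_eq_0_iff)

lemma bounded_clinearI:
  assumes "\<And>x y. f (x + y) = f x + f y" "\<And>c x. f (c *\<^sub>C x) = c *\<^sub>C f x"
    and "\<And>x. norm (f x) \<le> K * norm x"
  shows "bounded_clinear f"
  unfolding bounded_clinear_def
proof (intro conjI allI assms(2))
  show "bounded_linear f"
  proof (rule bounded_linear_intro[where K = K])
    show "f (r *\<^sub>R x) = r *\<^sub>R f x" for r x
      using assms(2)[of "complex_of_real r" x] by (simp add: scaleC_of_real)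
  qed (use assms in \<open>auto simp: mult.commute\<close>)
qed

lemma bounded_clinear_add: "bounded_clinear f \<Longrightarrow> f (x + y) = f x + f y"
  and bounded_clinear_scaleC: "bounded_clinear f \<Longrightarrow> f (c *\<^sub>C x) = c *\<^sub>C f x"
  by (auto simp: bounded_clinear_def linear_simps)

lemma bounded_clinear_bound:
  assumes "bounded_clinear f"
  obtains K where "0 \<le> K" "\<And>x. norm (f x) \<le> K * norm x"
proof -
  have "bounded_linear f" using assms by (simp add: bounded_clinear_def)
  then obtain K where "0 \<le> K" "\<forall>x. norm (f x) \<le> norm x * K"
    using bounded_linear.nonneg_bounded by blast
  then show thesis using that by (simp add: mult.commute)
qed

lemma bounded_clinear_plus:
  assumes "bounded_clinear f" "bounded_clinear g"
  shows "bounded_clinear (\<lambda>x. f x + g x)"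
  using assms by (auto simp: bounded_clinear_def scaleC_add_right intro: bounded_linear_add)

lemma bounded_clinear_minus:
  assumes "bounded_clinear f" "bounded_clinear g"
  shows "bounded_clinear (\<lambda>x. f x - g x)"
proof -
  have "c *\<^sub>C (x - y) = c *\<^sub>C x - c *\<^sub>C y" for c and x y :: 'b
    by (metis add_diff_cancel_right' diff_add_cancel scaleC_add_right)
  then show ?thesis
    using assms by (auto simp: bounded_clinear_def intro: bounded_linear_sub)
qed

lemma bounded_clinear_compose:
  assumes "bounded_clinear f" "bounded_clinear g"
  shows "bounded_clinear (\<lambda>x. f (g x))"
  using assms by (auto simp: bounded_clinear_def intro: bounded_linear_compose)

lemma bounded_clinear_mult_left: "bounded_clinear (\<lambda>x. (a :: 'a::cstar_algebra) * x)"
  by (rule bounded_clinearI[where K = "norm a"])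
    (simp_all add: distrib_left scaleC_mult_right norm_mult_ineq)

lemma cinner_add_right: "cinner x (y + z) = cinner x y + cinner x z"
  by (metis cinner_add_left cinner_commute complex_cnj_add)

lemma cinner_scaleC_right: "cinner x (c *\<^sub>C y) = cnj c * cinner x y"
  by (metis cinner_scaleC_left cinner_commute complex_cnj_mult)

text \<open>The triangle inequality is part of the given norm, so Cauchy-Schwarz is derived from it
  by expanding the square of \<open>norm (x + y)\<close>.\<close>

lemma Re_cinner_le: "Re (cinner x y) \<le> norm x * norm y"
proof -
  have "cinner (x + y) (x + y) = cinner x x + cinner y y + (cinner x y + cnj (cinner x y))"
    using cinner_commute[of y x] by (simp add: cinner_add_left cinner_add_right)
  then have "(norm (x + y))\<^sup>2 = (norm x)\<^sup>2 + (norm y)\<^sup>2 + 2 * Re (cinner x y)"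
    unfolding cinner_self by (simp add: complex_eq_iff)
  moreover have "(norm (x + y))\<^sup>2 \<le> (norm x + norm y)\<^sup>2"
    by (intro power_mono norm_triangle_ineq) simp
  ultimately show ?thesis by (simp add: power2_sum)
qed

lemma norm_cinner_le: "cmod (cinner x y) \<le> norm x * norm y"
proof (cases "cinner x y = 0")
  case False
  \<comment> \<open>A unimodular factor that rotates the inner product onto the positive real
    axis.\<close>
  define c where "c = cnj (cinner x y) / cmod (cinner x y)"
  have "c * cinner x y = cmod (cinner x y)"
    using False complex_norm_square[of "cinner x y"]
    by (simp add: c_def field_simps power2_eq_square)
  then have "cmod (cinner x y) = Re (cinner (c *\<^sub>C x) y)"
    by (simp add: cinner_scaleC_left)
  also have "\<dots> \<le> norm (c *\<^sub>C x) * norm y" by (rule Re_cinner_le)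
  also have "norm (c *\<^sub>C x) = norm x"
    using False by (simp add: norm_scaleC c_def norm_divide)
  finally show ?thesis .
qed simp

lemma bounded_clinear_cinner_left: "bounded_clinear (\<lambda>x. cinner x y)"
  by (rule bounded_clinearI[where K = "norm y"])
    (auto simp: cinner_add_left cinner_scaleC_left scaleC_complex_def mult.commute[of "norm y"]
      norm_cinner_le)

section \<open>Matrix units and scalar matrices over one element\<close>

lemma bounded_clinear_mat_unit: "bounded_clinear (mat_unit i j :: 'a::comm_cstar_algebra \<Rightarrow> _)"
proof (rule bounded_clinearI[where K = 1])
  fix x y :: 'a and c
  show "mat_unit i j (x + y) = mat_unit i j x + mat_unit i j y"
    by (rule mat2_eqI) (simp add: mat_unit_def plus_mat2_def)
  show "mat_unit i j (c *\<^sub>C x) = c *\<^sub>C mat_unit i j x"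
    by (rule mat2_eqI) (simp add: mat_unit_def scaleC_mat2_def matrix_scaleC_def)
  show "norm (mat_unit i j x) \<le> 1 * norm x"
    using matrix_norm_le_sum[of "to_matrix (mat_unit i j x)"] exhaust_2[of i] exhaust_2[of j]
    by (auto simp: norm_mat2_def mat_unit_def sum_2)
qed

text \<open>The elementary tensor of \<open>x\<close> with the scalar matrix with rows
  \<open>(a, b)\<close> and \<open>(c, d)\<close>. Over a projection, scalar projections yield the
  test projections of the matrix algebra.\<close>

definition tensor_mat :: "'a::cstar_algebra \<Rightarrow> complex \<Rightarrow> complex \<Rightarrow> complex \<Rightarrow> complex \<Rightarrow> 'a mat2"
  where "tensor_mat x a b c d =
    of_matrix (\<chi> i j. (if i = 1 then if j = 1 then a else b else if j = 1 then c else d) *\<^sub>C x)"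

lemma tensor_mat_mult:
  fixes x y :: "'a::comm_cstar_algebra"
  shows "tensor_mat x a b c d * tensor_mat y a' b' c' d'
    = tensor_mat (x * y) (a * a' + b * c') (a * b' + b * d') (c * a' + d * c') (c * b' + d * d')"
  by (rule mat2_eqI)
    (simp add: tensor_mat_def times_mat2_def matrix_matrix_mult_def sum_2 scaleC_mult_left
      scaleC_mult_right scaleC_scaleC scaleC_add_left mult.commute)

lemma star_tensor_mat:
  fixes x :: "'a::comm_cstar_algebra"
  shows "star (tensor_mat x a b c d) = tensor_mat (star x) (cnj a) (cnj c) (cnj b) (cnj d)"
  by (rule mat2_eqI) (simp add: tensor_mat_def star_mat2_def matrix_star_def star_scaleC)

lemma tensor_mat_zero: "tensor_mat (0::'a::comm_cstar_algebra) a b c d = 0"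
  by (rule mat2_eqI) (simp add: tensor_mat_def zero_mat2_def)

lemma tensor_mat_eq_mat_unit:
  fixes x :: "'a::comm_cstar_algebra"
  shows "tensor_mat x a b c d = a *\<^sub>C mat_unit 1 1 x + b *\<^sub>C mat_unit 1 2 x
    + c *\<^sub>C mat_unit 2 1 x + d *\<^sub>C mat_unit 2 2 x"
proof (rule mat2_eqI)
  fix i j :: 2
  show "to_matrix (tensor_mat x a b c d) $ i $ j = to_matrix (a *\<^sub>C mat_unit 1 1 x + b *\<^sub>C mat_unit 1 2 x
    + c *\<^sub>C mat_unit 2 1 x + d *\<^sub>C mat_unit 2 2 x) $ i $ j"
    using exhaust_2[of i] exhaust_2[of j]
    by (auto simp: tensor_mat_def mat_unit_def plus_mat2_def scaleC_mat2_def matrix_scaleC_def)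
qed

lemma is_projection_tensor_mat:
  fixes p :: "'a::comm_cstar_algebra"
  assumes "is_projection p" "cnj a = a" "c = cnj b" "cnj d = d"
    "a * a + b * c = a" "a * b + b * d = b" "c * b + d * d = d"
  shows "is_projection (tensor_mat p a b c d)"
proof -
  have "c * a + d * c = c"
    using arg_cong[OF assms(6), of cnj] assms(2-4) by (simp add: mult.commute)
  then show ?thesis
    using assms by (simp add: is_projection_def tensor_mat_mult star_tensor_mat)
qed

text \<open>Four scalar projections span the 2 by 2 matrices: the two diagonal ones, and those with
  diagonal \<open>1/2\<close> and upper corner \<open>1/2\<close> or \<open>\<i>/2\<close>.\<close>

lemma eq_0_on_mat_unit_if_0_on_projections:
  fixes V :: "'a::comm_cstar_algebra mat2 \<Rightarrow> 'b::complex_normed_vector"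
  assumes V: "bounded_clinear V" and p: "is_projection p"
    and 0: "\<And>a b c d. is_projection (tensor_mat p a b c d) \<Longrightarrow> V (tensor_mat p a b c d) = 0"
  shows "V (mat_unit i j p) = 0"
proof -
  have V_tensor: "V (tensor_mat p a b c d) = a *\<^sub>C V (mat_unit 1 1 p) + b *\<^sub>C V (mat_unit 1 2 p)
    + c *\<^sub>C V (mat_unit 2 1 p) + d *\<^sub>C V (mat_unit 2 2 p)" for a b c d
    by (simp add: tensor_mat_eq_mat_unit bounded_clinear_add[OF V] bounded_clinear_scaleC[OF V])
  have 11: "V (mat_unit 1 1 p) = 0"
    using 0[of 1 0 0 0] is_projection_tensor_mat[OF p, of 1 0 0 0] by (simp add: V_tensor)
  have 22: "V (mat_unit 2 2 p) = 0"
    using 0[of 0 0 0 1] is_projection_tensor_mat[OF p, of 0 0 0 1] by (simp add: V_tensor)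
  have half: "(1/2) *\<^sub>C x + (1/2) *\<^sub>C y = 0 \<Longrightarrow> y = - x" for x y :: 'b
  proof -
    assume "(1/2) *\<^sub>C x + (1/2) *\<^sub>C y = 0"
    then have "2 *\<^sub>C (1/2) *\<^sub>C (x + y) = 0" by (simp add: scaleC_add_right)
    then have "x + y = 0" unfolding scaleC_scaleC by simp
    then show "y = - x" by (simp add: add_eq_0_iff)
  qed
  have "V (tensor_mat p (1/2) (1/2) (1/2) (1/2)) = 0"
    by (rule 0, rule is_projection_tensor_mat[OF p]) simp_all
  then have a: "V (mat_unit 2 1 p) = - V (mat_unit 1 2 p)"
    by (intro half) (simp add: V_tensor 11 22)
  have "V (tensor_mat p (1/2) (\<i>/2) (-\<i>/2) (1/2)) = 0"
    by (rule 0, rule is_projection_tensor_mat[OF p]) simp_all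
  then have "(\<i>/2) *\<^sub>C V (mat_unit 1 2 p) + (-\<i>/2) *\<^sub>C (- V (mat_unit 1 2 p)) = 0"
    by (simp add: V_tensor 11 22 a)
  moreover have "(-\<i>/2) *\<^sub>C (- x) = (\<i>/2) *\<^sub>C x" for x :: 'b
    by (simp add: scaleC_minus_left scaleC_minus_right)
  ultimately have "(\<i>/2 + \<i>/2) *\<^sub>C V (mat_unit 1 2 p) = 0" by (simp only: scaleC_add_left)
  then have 12: "V (mat_unit 1 2 p) = 0"
    using norm_scaleC[of \<i> "V (mat_unit 1 2 p)"] by simp
  show ?thesis
    using 11 12 22 a exhaust_2[of i] exhaust_2[of j] by auto
qed

section \<open>Inner products of images of matrix units\<close>

text \<open>Off-diagonal matrix units are not projections, so the spanning argument is run in each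
  argument in turn. The second is moved to the front by conjugate symmetry, where the inner product
  is linear.\<close>

lemma ovf_mat_unit_orthogonal:
  fixes F :: "'m::comm_cstar_algebra mat2 \<Rightarrow> 'h::complex_hilbert"
  assumes F: "orthogonal_vector_field F"
    and p: "is_projection p" and q: "is_projection q" and pq: "p * q = 0"
  shows "cinner (F (mat_unit i j p)) (F (mat_unit k l q)) = 0"
proof -
  have bF: "bounded_clinear F" using F by (simp add: orthogonal_vector_field_def)
  have lin: "bounded_clinear (\<lambda>X. cinner (F X) y)" for y
    by (rule bounded_clinear_compose[OF bounded_clinear_cinner_left bF])
  have "cinner (F (mat_unit i j p)) (F (tensor_mat q a b c d)) = 0"
    if "is_projection (tensor_mat q a b c d)" for a b c d
    using F that
    by (intro eq_0_on_mat_unit_if_0_on_projections[OF lin p])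
      (simp add: orthogonal_vector_field_def tensor_mat_mult pq tensor_mat_zero)
  then have "cinner (F (mat_unit k l q)) (F (mat_unit i j p)) = 0"
    by (intro eq_0_on_mat_unit_if_0_on_projections[OF lin q]) (metis cinner_commute complex_cnj_zero)
  then show ?thesis by (metis cinner_commute complex_cnj_zero)
qed

text \<open>Both sides equal the inner product at \<open>r = q * p\<close>: split \<open>p\<close>,
  \<open>q\<close> and \<open>1\<close> into \<open>r\<close> plus a remainder, and the cross terms
  vanish by disjointness.\<close>

lemma ovf_cinner_projections:
  fixes F :: "'m::comm_cstar_algebra mat2 \<Rightarrow> 'h::complex_hilbert"
  assumes F: "orthogonal_vector_field F" and p: "is_projection p" and q: "is_projection q"
  shows "cinner (F (mat_unit i j p)) (F (mat_unit k l q))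
    = cinner (F (mat_unit i j (q * p))) (F (mat_unit k l 1))"
proof -
  have "bounded_clinear (\<lambda>x. F (mat_unit i j x))" for i j
    using F by (intro bounded_clinear_compose[OF _ bounded_clinear_mat_unit])
      (simp add: orthogonal_vector_field_def)
  then have add: "F (mat_unit i j (x + y)) = F (mat_unit i j x) + F (mat_unit i j y)" for i j x y
    by (rule bounded_clinear_add)
  note orth = ovf_mat_unit_orthogonal[OF F]
  have compl: "is_projection (1 - x)" if "is_projection x" for x :: 'm
    using that by (auto simp: is_projection_def star_diff algebra_simps)
  have prod: "is_projection (x * y)" if "is_projection x" "is_projection y" for x y :: 'm
    using that by (simp add: is_projection_def star_mult ac_simps) (metis mult.assoc mult.commute)
  have pp: "p * p = p" "q * q = q" using p q by (auto simp: is_projection_def)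
  have ppx: "p * (p * x) = p * x" "q * (q * x) = q * x" for x
    using pp by (simp_all flip: mult.assoc)
  have zero: "(p * (1 - q)) * q = 0" "(q * p) * (q * (1 - p)) = 0" "(q * p) * (1 - q * p) = 0"
    by (simp_all add: algebra_simps pp ppx)
  let ?r = "q * p"
  have "cinner (F (mat_unit i j p)) (F (mat_unit k l q))
      = cinner (F (mat_unit i j (?r + p * (1 - q)))) (F (mat_unit k l q))"
    by (simp add: algebra_simps)
  also have "\<dots> = cinner (F (mat_unit i j ?r)) (F (mat_unit k l q))"
    unfolding add cinner_add_left orth[OF prod[OF p compl[OF q]] q zero(1)] by simp
  also have "\<dots> = cinner (F (mat_unit i j ?r)) (F (mat_unit k l (?r + q * (1 - p))))"
    by (simp add: algebra_simps)
  also have "\<dots> = cinner (F (mat_unit i j ?r)) (F (mat_unit k l ?r))"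
    unfolding add cinner_add_right orth[OF prod[OF q p] prod[OF q compl[OF p]] zero(2)] by simp
  also have "\<dots> = cinner (F (mat_unit i j ?r)) (F (mat_unit k l (?r + (1 - ?r))))"
    unfolding add cinner_add_right orth[OF prod[OF q p] compl[OF prod[OF q p]] zero(3)] by simp
  finally show ?thesis by simp
qed

text \<open>First \<open>a\<close> is extended from projections with \<open>b\<close> a projection,
  then \<open>b\<close>. Both sides are conjugate-linear in \<open>b\<close>, so the second
  extension is done with the arguments of the inner product swapped.\<close>

lemma ovf_cinner:
  fixes D :: "'m::comm_cstar_algebra \<Rightarrow> 'e::complex_banach \<Rightarrow> complex"
    and F :: "'m mat2 \<Rightarrow> 'h::complex_hilbert"
  assumes D: "wstar_predual D" and F: "orthogonal_vector_field F"
  shows "cinner (F (mat_unit i j a)) (F (mat_unit k l b))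
    = cinner (F (mat_unit i j (star b * a))) (F (mat_unit k l 1))"
proof -
  have F_unit: "bounded_clinear (\<lambda>x. F (mat_unit i j x))" for i j
    using F by (intro bounded_clinear_compose[OF _ bounded_clinear_mat_unit])
      (simp add: orthogonal_vector_field_def)
  have cin: "bounded_clinear (\<lambda>x. cinner (F (mat_unit i j x)) y)" for i j y
    by (rule bounded_clinear_compose[OF bounded_clinear_cinner_left F_unit])
  have proj: "cinner (F (mat_unit i j a)) (F (mat_unit k l q))
      = cinner (F (mat_unit i j (q * a))) (F (mat_unit k l 1))" if q: "is_projection q" for a q
  proof -
    have "cinner (F (mat_unit i j a)) (F (mat_unit k l q))
        - cinner (F (mat_unit i j (q * a))) (F (mat_unit k l 1)) = 0"
    proof (rule bounded_clinear_0_if_0_on_projections[OF D, where a = a])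
      show "bounded_clinear (\<lambda>a. cinner (F (mat_unit i j a)) (F (mat_unit k l q))
          - cinner (F (mat_unit i j (q * a))) (F (mat_unit k l 1)))"
        by (intro bounded_clinear_minus cin bounded_clinear_compose[OF cin bounded_clinear_mult_left])
    qed (use ovf_cinner_projections[OF F _ q] in auto)
    then show ?thesis by simp
  qed
  have "cinner (F (mat_unit k l b)) (F (mat_unit i j a))
      - cinner (F (mat_unit k l 1)) (F (mat_unit i j (star b * a))) = 0"
  proof (rule bounded_clinear_0_if_0_on_projections[OF D, where a = b])
    let ?g = "\<lambda>b. cinner (F (mat_unit k l 1)) (F (mat_unit i j (star b * a)))"
    obtain K where K: "0 \<le> K" "\<And>x. norm (F (mat_unit i j x)) \<le> K * norm x"
      using bounded_clinear_bound[OF F_unit] by blast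
    have "bounded_clinear ?g"
    proof (rule bounded_clinearI[where K = "norm (F (mat_unit k l 1)) * K * norm a"])
      fix x y :: 'm and c
      show "?g (x + y) = ?g x + ?g y"
        by (simp add: star_add distrib_right bounded_clinear_add[OF F_unit] cinner_add_right)
      show "?g (c *\<^sub>C x) = c *\<^sub>C ?g x"
        by (simp add: star_scaleC scaleC_mult_left bounded_clinear_scaleC[OF F_unit]
            cinner_scaleC_right scaleC_complex_def)
      have "norm (?g x) \<le> norm (F (mat_unit k l 1)) * norm (F (mat_unit i j (star x * a)))"
        by (rule norm_cinner_le)
      also have "\<dots> \<le> norm (F (mat_unit k l 1)) * (K * (norm x * norm a))"
        using norm_mult_ineq[of "star x" a] K(1)
        by (intro mult_left_mono order_trans[OF K(2)]) (auto simp: norm_star)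
      finally show "norm (?g x) \<le> norm (F (mat_unit k l 1)) * K * norm a * norm x"
        by (simp add: ac_simps)
    qed
    then show "bounded_clinear (\<lambda>b. cinner (F (mat_unit k l b)) (F (mat_unit i j a)) - ?g b)"
      by (intro bounded_clinear_minus cin)
    fix q :: 'm assume q: "is_projection q"
    then have "star q = q" by (simp add: is_projection_def)
    then have "cnj (cinner (F (mat_unit i j a)) (F (mat_unit k l q)))
        = cnj (cinner (F (mat_unit i j (star q * a))) (F (mat_unit k l 1)))"
      using proj[OF q] by simp
    then show "cinner (F (mat_unit k l q)) (F (mat_unit i j a)) - ?g q = 0"
      by (simp flip: cinner_commute)
  qed
  then have "cnj (cinner (F (mat_unit k l b)) (F (mat_unit i j a)))
      = cnj (cinner (F (mat_unit k l 1)) (F (mat_unit i j (star b * a))))" by simp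
  then show ?thesis by (simp flip: cinner_commute)
qed

text \<open>\<open>A\<close>, \<open>U\<close>, \<open>V\<close>, \<open>B\<close> stand for the
  images of the four matrix units over one projection, and \<open>orth\<close> is orthogonality for
  a complementary pair of rank-one scalar projections.\<close>

lemma cinner_relations_2x2:
  fixes A B U V :: "'h::complex_hilbert"
  assumes orth: "\<And>t u. cnj t = t \<Longrightarrow> t * t + u * cnj u = t \<Longrightarrow>
    cinner (t *\<^sub>C A + u *\<^sub>C U + cnj u *\<^sub>C V + (1 - t) *\<^sub>C B)
      ((1 - t) *\<^sub>C A + (- u) *\<^sub>C U + cnj (- u) *\<^sub>C V + t *\<^sub>C B) = 0"
  shows "cinner A B = 0" "cinner U V = 0" "cinner U U + cinner V V = cinner A A + cinner B B"
    "cinner U A = cinner B V" "cinner V A = cinner B U"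
proof -
  note expand = cinner_add_left cinner_add_right cinner_scaleC_left cinner_scaleC_right
  show AB: "cinner A B = 0" using orth[of 1 0] by (simp add: expand)
  then have BA: "cinner B A = 0" by (metis cinner_commute complex_cnj_zero)
  \<comment> \<open>Setting \<open>u = s * z\<close> with \<open>s\<close> real and \<open>z\<close>
    unimodular separates the modulus of \<open>u\<close> from its phase.\<close>
  define W where "W z = z *\<^sub>C U + cnj z *\<^sub>C V" for z
  have W: "cinner (W z) (W z) = cinner A A + cinner B B \<and> cinner (W z) A = cinner B (W z)"
    if z: "z * cnj z = 1" for z
  proof -
    have eq: "t * (1 - t) * (cinner A A + cinner B B) - s * s * cinner (W z) (W z)
        + s * ((1 - t) * (cinner (W z) A - cinner B (W z)) + t * (cinner (W z) B - cinner A (W z))) = 0"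
      if "cnj t = t" "cnj s = s" "t * t + s * s = t" for t s
    proof -
      have "(s * z) * cnj (s * z) = (s * s) * (z * cnj z)" by (simp add: that(2) ac_simps)
      then have "t * t + (s * z) * cnj (s * z) = t" by (simp only: z that(3) mult_1_right)
      then have "cinner (t *\<^sub>C A + (s * z) *\<^sub>C U + cnj (s * z) *\<^sub>C V + (1 - t) *\<^sub>C B)
          ((1 - t) *\<^sub>C A + (- (s * z)) *\<^sub>C U + cnj (- (s * z)) *\<^sub>C V + t *\<^sub>C B) = 0"
        by (rule orth[OF that(1)])
      then show ?thesis
        by (simp add: expand W_def that AB BA algebra_simps)
    qed
    define N X Y M where "N = cinner A A + cinner B B" and "X = cinner (W z) A - cinner B (W z)"
      and "Y = cinner (W z) B - cinner A (W z)" and "M = cinner (W z) (W z)"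
    note eq = eq[folded N_def X_def Y_def M_def]
    \<comment> \<open>The parameters are rational points of \<open>t * t + s * s = t\<close>.
      Flipping the sign of \<open>s\<close> separates \<open>M = N\<close> from a relation between
      \<open>X\<close> and \<open>Y\<close>; exchanging \<open>t\<close> with \<open>1 - t\<close>
      gives a second, independent relation.\<close>
    have "4/25 * N - 4/25 * M + 2/5 * (1/5 * X + 4/5 * Y) = 0"
      using eq[of "4/5" "2/5"] by simp
    moreover have "4/25 * N - 4/25 * M - 2/5 * (1/5 * X + 4/5 * Y) = 0"
      using eq[of "4/5" "- 2/5"] by simp
    moreover have "4/25 * N - 4/25 * M + 2/5 * (4/5 * X + 1/5 * Y) = 0"
      using eq[of "1/5" "2/5"] by simp
    ultimately have "M = N" "X = 0"
      by (simp_all add: complex_eq_iff) argo+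
    then show ?thesis by (simp add: N_def M_def X_def)
  qed
  have W1: "z * cnj z * cinner U U + z * z * cinner U V + cnj z * cnj z * cinner V U + z * cnj z * cinner V V
      = cinner A A + cinner B B"
    and W2: "z * cinner U A + cnj z * cinner V A = cnj z * cinner B U + z * cinner B V"
    if "z * cnj z = 1" for z
    using W[OF that] by (simp_all add: W_def expand algebra_simps)
  have s: "cinner U U + cinner U V + cinner V U + cinner V V = cinner A A + cinner B B"
    "cinner U U - cinner U V - cinner V U + cinner V V = cinner A A + cinner B B"
    using W1[of 1] W1[of \<i>] by simp_all
  have VU: "cinner V U = - cinner U V"
    using s by (simp add: complex_eq_iff)
  then show UV: "cinner U U + cinner V V = cinner A A + cinner B B" using s by simp
  \<comment> \<open>The phases 1 and \<open>\<i>\<close> only show that the two mixed terms are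
    opposite. A unimodular \<open>z\<close> whose square is not real is needed to make them
    vanish.\<close>
  have "(cinner U U + cinner V V) + (48/25 * \<i>) * cinner U V = cinner A A + cinner B B"
    using W1[of "3/5 + 4/5 * \<i>"] VU by (simp add: algebra_simps)
  then show "cinner U V = 0" by (simp add: UV)
  have "cinner U A + cinner V A = cinner B U + cinner B V"
    "cinner U A - cinner V A = cinner B V - cinner B U"
  proof -
    show "cinner U A + cinner V A = cinner B U + cinner B V" using W2[of 1] by simp
    have "\<i> * (cinner U A - cinner V A) = \<i> * (cinner B V - cinner B U)"
      using W2[of \<i>] by (simp add: algebra_simps)
    then show "cinner U A - cinner V A = cinner B V - cinner B U" by simp
  qed
  then show "cinner U A = cinner B V" "cinner V A = cinner B U"
    by (simp_all add: complex_eq_iff)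
qed

theorem proposition1:
  fixes D :: "'m::comm_cstar_algebra \<Rightarrow> 'e::complex_banach \<Rightarrow> complex"
    and F :: "'m mat2 \<Rightarrow> 'h::complex_hilbert"
    and F' :: "2 \<Rightarrow> 2 \<Rightarrow> 'm \<Rightarrow> 'h"
  assumes "wstar_predual D"
    and "orthogonal_vector_field F"
    and "\<And>i j a. F' i j a = F (mat_unit i j a)"
  shows "(\<forall>a b. cinner (F' 1 1 a) (F' 2 2 b) = 0 \<and> cinner (F' 1 2 a) (F' 2 1 b) = 0) \<and>
    (\<forall>a. (norm (F' 1 2 a))\<^sup>2 + (norm (F' 2 1 a))\<^sup>2 = (norm (F' 1 1 a))\<^sup>2 + (norm (F' 2 2 a))\<^sup>2) \<and>
    (\<forall>a b i j k l. cinner (F' i j a) (F' k l b) = cinner (F' i j (star b * a)) (F' k l 1)) \<and>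
    (\<forall>\<pi>. is_projection \<pi> \<longrightarrow>
      cinner (F' 1 2 \<pi>) (F' 1 1 1) = cinner (F' 2 2 1) (F' 2 1 \<pi>) \<and>
      cinner (F' 2 1 \<pi>) (F' 1 1 1) = cinner (F' 2 2 1) (F' 1 2 \<pi>))"
proof -
  note D = assms(1) and F = assms(2) and F' = assms(3)
  have iii: "cinner (F' i j a) (F' k l b) = cinner (F' i j (star b * a)) (F' k l 1)" for a b i j k l
    unfolding F' by (rule ovf_cinner[OF D F])
  have bF: "bounded_clinear F" using F by (simp add: orthogonal_vector_field_def)
  have rel: "cinner (F' 1 1 p) (F' 2 2 p) = 0" "cinner (F' 1 2 p) (F' 2 1 p) = 0"
    "cinner (F' 1 2 p) (F' 1 2 p) + cinner (F' 2 1 p) (F' 2 1 p)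
      = cinner (F' 1 1 p) (F' 1 1 p) + cinner (F' 2 2 p) (F' 2 2 p)"
    "cinner (F' 1 2 p) (F' 1 1 p) = cinner (F' 2 2 p) (F' 2 1 p)"
    "cinner (F' 2 1 p) (F' 1 1 p) = cinner (F' 2 2 p) (F' 1 2 p)" if p: "is_projection p" for p
  proof -
    have "cinner (t *\<^sub>C F' 1 1 p + u *\<^sub>C F' 1 2 p + cnj u *\<^sub>C F' 2 1 p + (1 - t) *\<^sub>C F' 2 2 p)
        ((1 - t) *\<^sub>C F' 1 1 p + (- u) *\<^sub>C F' 1 2 p + cnj (- u) *\<^sub>C F' 2 1 p + t *\<^sub>C F' 2 2 p) = 0"
      if t: "cnj t = t" and tu: "t * t + u * cnj u = t" for t u
    proof -
      have tu': "u * cnj u = t - t * t" using tu by (simp add: algebra_simps)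
      let ?P = "tensor_mat p t u (cnj u) (1 - t)" and ?Q = "tensor_mat p (1 - t) (- u) (cnj (- u)) t"
      have "is_projection ?P" "is_projection ?Q"
        by (rule is_projection_tensor_mat[OF p]; simp add: t tu' algebra_simps)+
      moreover have "?P * ?Q = tensor_mat p 0 0 0 0"
        using p by (simp add: tensor_mat_mult is_projection_def tu' algebra_simps)
      then have "?P * ?Q = 0" by (simp add: tensor_mat_eq_mat_unit)
      ultimately have "cinner (F ?P) (F ?Q) = 0"
        using F unfolding orthogonal_vector_field_def by blast
      then show ?thesis
        unfolding tensor_mat_eq_mat_unit bounded_clinear_add[OF bF] bounded_clinear_scaleC[OF bF] F' .
    qed
    note cinner_relations_2x2[OF this]
    then show "cinner (F' 1 1 p) (F' 2 2 p) = 0" "cinner (F' 1 2 p) (F' 2 1 p) = 0"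
      "cinner (F' 1 2 p) (F' 1 2 p) + cinner (F' 2 1 p) (F' 2 1 p)
        = cinner (F' 1 1 p) (F' 1 1 p) + cinner (F' 2 2 p) (F' 2 2 p)"
      "cinner (F' 1 2 p) (F' 1 1 p) = cinner (F' 2 2 p) (F' 2 1 p)"
      "cinner (F' 2 1 p) (F' 1 1 p) = cinner (F' 2 2 p) (F' 1 2 p)" by blast+
  qed
  \<comment> \<open>Part (iii) at \<open>a = b = p\<close>, where \<open>star p * p = p\<close>,
    exchanges \<open>1\<close> for \<open>p\<close> in the second argument.\<close>
  have unit: "cinner (F' i j p) (F' k l 1) = cinner (F' i j p) (F' k l p)" if "is_projection p" for i j k l p
    using iii[of i j p k l p] that by (simp add: is_projection_def)
  have unit': "cinner (F' k l 1) (F' i j p) = cinner (F' k l p) (F' i j p)" if "is_projection p" for i j k l p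
    using unit[OF that] by (metis cinner_commute)
  have lin: "bounded_clinear (\<lambda>x. cinner (F' i j x) y)" for i j y
    unfolding F'
    by (rule bounded_clinear_compose[OF bounded_clinear_cinner_left
          bounded_clinear_compose[OF bF bounded_clinear_mat_unit]])
  note density = bounded_clinear_0_if_0_on_projections[OF D]
  \<comment> \<open>By (iii) both inner products are values at \<open>star b * a\<close> of bounded
    linear functionals, which vanish on projections.\<close>
  have i: "cinner (F' 1 1 a) (F' 2 2 b) = 0 \<and> cinner (F' 1 2 a) (F' 2 1 b) = 0" for a b
    unfolding iii[of _ _ a _ _ b]
    by (intro conjI density[OF lin, where a = "star b * a"]) (simp_all add: unit rel)
  have ii: "(norm (F' 1 2 a))\<^sup>2 + (norm (F' 2 1 a))\<^sup>2 = (norm (F' 1 1 a))\<^sup>2 + (norm (F' 2 2 a))\<^sup>2" for a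
  proof -
    \<comment> \<open>The identity is quadratic in \<open>a\<close> but, by (iii), linear in
      \<open>star a * a\<close>, so testing on projections suffices.\<close>
    let ?f = "\<lambda>x. (cinner (F' 1 2 x) (F' 1 2 1) + cinner (F' 2 1 x) (F' 2 1 1))
      - (cinner (F' 1 1 x) (F' 1 1 1) + cinner (F' 2 2 x) (F' 2 2 1))"
    have "?f (star a * a) = 0"
      by (rule density[where a = "star a * a"], intro bounded_clinear_minus bounded_clinear_plus lin) (simp add: unit rel)
    then have "complex_of_real ((norm (F' 1 2 a))\<^sup>2 + (norm (F' 2 1 a))\<^sup>2)
        = complex_of_real ((norm (F' 1 1 a))\<^sup>2 + (norm (F' 2 2 a))\<^sup>2)"
      by (simp add: iii[of _ _ a _ _ a, symmetric] cinner_self)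
    then show ?thesis by (simp only: of_real_eq_iff)
  qed
  show ?thesis
    using i ii iii by (auto simp: unit unit' rel)
qed

end
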